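(* Over the class of finite (unordered) trees with navigational signature $\sigma=\{\downarrow,\downarrow_+\}$ (plus arbitrary unary predicates), for formulas with one free variable: $$\mathrm{CoreXPath}[\sigma]\equiv\mathrm{GF}^2[\sigma]\equiv\mathrm{UNFO}[\sigma]\prec\mathrm{FO}^2[\sigma]\prec\mathrm{C}^2[\sigma]\equiv\mathrm{F}_1[\sigma].$$
   Context: Let $\mathbb N^*$ be the set of finite sequences of naturals. A tree is a finite structure whose universe $T\subseteq\mathbb N^*$ satisfies: if $\langle\alpha,i\rangle\in T$ then $\alpha\in T$ and, if $i>0$, $\langle\alpha,i-1\rangle\in T$; here it interprets finitely many unary predicates arbitrarily and only the navigational relations $a\downarrow b$ (child) iff $b=\langle a,i\rangle$, and $a\downarrow_+ b$ (descendant) iff $b=\langle a,\beta\rangle$ with $\beta$ nonempty. Logics: $\mathrm{F}_1$ is the smallest set of first-order formulas containing atoms and equalities, closed under $\vee,\neg$, and such that if $\varphi$ has free variables among $x_0,\dots,x_k$ then $\exists x_0\dots x_k\varphi$ and $\exists x_1\dots x_k\varphi$ are in it. $\mathrm{UNFO}$: smallest set containing atoms and equalities, closed under $\vee,\wedge,\exists$, and under $\neg\varphi$ when $\varphi$ has at most one free variable. $\mathrm{FO}^2$: first-order formulas with two variables; $\mathrm{C}^2$: $\mathrm{FO}^2$ plus counting quantifiers $\exists^{\ge C}y$, $\exists^{\le C}y$; $\mathrm{GF}^2$: two-variable guarded fragment (every quantification of the form $\exists\bar v(\alpha\wedge\psi)$ or $\forall\bar v(\alpha\to\psi)$ with $\alpha$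 an atom containing all free variables of $\psi$). $\mathrm{CoreXPath}[\sigma]$: modal formulas built from propositional variables (the unary predicates) by Boolean connectives and the modalities $\langle\downarrow\rangle,\langle\uparrow\rangle,\langle\downarrow_+\rangle,\langle\uparrow^+\rangle$, referring respectively to some child, the parent, some descendant, some ancestor; identified with its standard first-order translation (one free variable). Expressivity: $L_1\preceq L_2$ over a class if every $L_1$-formula with one free variable has an equivalent (on all structures of the class, at all elements) $L_2$-formula with one free variable over the same signature; $L_1\equiv L_2$ means both $L_1\preceq L_2$ and $L_2\preceq L_1$; $L_1\prec L_2$ means $L_1\preceq L_2$ but not $L_2\preceq L_1$. *)

theory Defs
  imports Main
begin

text \<open>First-order formulas with counting quantifiers over the navigational signature
  consisting of the child and descendant relations, and unary predicates from \<open>'p\<close>.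
  Variables are natural numbers.  All the logics considered are sets of such formulas.\<close>

datatype (preds: 'p) fo =
    Pred 'p nat
  | Child nat nat
  | Desc nat nat
  | Equal nat nat
  | Neg "'p fo"
  | Conj "'p fo" "'p fo"
  | Disj "'p fo" "'p fo"
  | Ex nat "'p fo"
  | All nat "'p fo"
  | AtLeast nat nat "'p fo"  \<comment> \<open>\<open>AtLeast C x \<phi>\<close> is \<open>\<exists>\<^sup>\<ge>\<^sup>C x. \<phi>\<close>\<close>
  | AtMost nat nat "'p fo"

abbreviation Imp :: "'p fo \<Rightarrow> 'p fo \<Rightarrow> 'p fo" where
  "Imp \<phi> \<psi> \<equiv> Disj (Neg \<phi>) \<psi>"

definition exs :: "nat list \<Rightarrow> 'p fo \<Rightarrow> 'p fo" where
  "exs xs \<phi> = foldr Ex xs \<phi>"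

definition alls :: "nat list \<Rightarrow> 'p fo \<Rightarrow> 'p fo" where
  "alls xs \<phi> = foldr All xs \<phi>"

fun atomic :: "'p fo \<Rightarrow> bool" where
  "atomic (Pred p x) = True"
| "atomic (Child x y) = True"
| "atomic (Desc x y) = True"
| "atomic (Equal x y) = True"
| "atomic _ = False"

fun fv :: "'p fo \<Rightarrow> nat set" where
  "fv (Pred p x) = {x}"
| "fv (Child x y) = {x, y}"
| "fv (Desc x y) = {x, y}"
| "fv (Equal x y) = {x, y}"
| "fv (Neg \<phi>) = fv \<phi>"
| "fv (Conj \<phi> \<psi>) = fv \<phi> \<union> fv \<psi>"
| "fv (Disj \<phi> \<psi>) = fv \<phi> \<union> fv \<psi>"
| "fv (Ex x \<phi>) = fv \<phi> - {x}"
| "fv (All x \<phi>) = fv \<phi> - {x}"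
| "fv (AtLeast C x \<phi>) = fv \<phi> - {x}"
| "fv (AtMost C x \<phi>) = fv \<phi> - {x}"

text \<open>All variables of a formula, free or bound.\<close>

fun vars :: "'p fo \<Rightarrow> nat set" where
  "vars (Pred p x) = {x}"
| "vars (Child x y) = {x, y}"
| "vars (Desc x y) = {x, y}"
| "vars (Equal x y) = {x, y}"
| "vars (Neg \<phi>) = vars \<phi>"
| "vars (Conj \<phi> \<psi>) = vars \<phi> \<union> vars \<psi>"
| "vars (Disj \<phi> \<psi>) = vars \<phi> \<union> vars \<psi>"
| "vars (Ex x \<phi>) = insert x (vars \<phi>)"
| "vars (All x \<phi>) = insert x (vars \<phi>)"
| "vars (AtLeast C x \<phi>) = insert x (vars \<phi>)"
| "vars (AtMost C x \<phi>) = insert x (vars \<phi>)"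

fun counting_free :: "'p fo \<Rightarrow> bool" where
  "counting_free (Neg \<phi>) = counting_free \<phi>"
| "counting_free (Conj \<phi> \<psi>) = (counting_free \<phi> \<and> counting_free \<psi>)"
| "counting_free (Disj \<phi> \<psi>) = (counting_free \<phi> \<and> counting_free \<psi>)"
| "counting_free (Ex x \<phi>) = counting_free \<phi>"
| "counting_free (All x \<phi>) = counting_free \<phi>"
| "counting_free (AtLeast C x \<phi>) = False"
| "counting_free (AtMost C x \<phi>) = False"
| "counting_free _ = True"


text \<open>Finite trees: \<open>T\<close> is the universe and \<open>V\<close> interprets the unary predicates.  A predicate
  outside the signature of a formula does not influence its truth value, so \<open>V\<close> may be defined
  on all of \<open>'p\<close>.\<close>

definition finite_tree :: "nat list set \<Rightarrow> ('p \<Rightarrow> nat list set) \<Rightarrow> bool" where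
  "finite_tree T V \<longleftrightarrow>
     finite T \<and> T \<noteq> {} \<and>
     (\<forall>\<alpha> i. \<alpha> @ [i] \<in> T \<longrightarrow> \<alpha> \<in> T \<and> (i > 0 \<longrightarrow> \<alpha> @ [i - 1] \<in> T)) \<and>
     (\<forall>p. V p \<subseteq> T)"

definition child :: "nat list \<Rightarrow> nat list \<Rightarrow> bool" where
  "child a b \<longleftrightarrow> (\<exists>i. b = a @ [i])"

definition descendant :: "nat list \<Rightarrow> nat list \<Rightarrow> bool" where
  "descendant a b \<longleftrightarrow> (\<exists>\<beta>. \<beta> \<noteq> [] \<and> b = a @ \<beta>)"

fun sat :: "nat list set \<Rightarrow> ('p \<Rightarrow> nat list set) \<Rightarrow> (nat \<Rightarrow> nat list) \<Rightarrow> 'p fo \<Rightarrow> bool" where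
  "sat T V s (Pred p x) \<longleftrightarrow> s x \<in> V p"
| "sat T V s (Child x y) \<longleftrightarrow> child (s x) (s y)"
| "sat T V s (Desc x y) \<longleftrightarrow> descendant (s x) (s y)"
| "sat T V s (Equal x y) \<longleftrightarrow> s x = s y"
| "sat T V s (Neg \<phi>) \<longleftrightarrow> \<not> sat T V s \<phi>"
| "sat T V s (Conj \<phi> \<psi>) \<longleftrightarrow> sat T V s \<phi> \<and> sat T V s \<psi>"
| "sat T V s (Disj \<phi> \<psi>) \<longleftrightarrow> sat T V s \<phi> \<or> sat T V s \<psi>"
| "sat T V s (Ex x \<phi>) \<longleftrightarrow> (\<exists>a\<in>T. sat T V (s(x := a)) \<phi>)"
| "sat T V s (All x \<phi>) \<longleftrightarrow> (\<forall>a\<in>T. sat T V (s(x := a)) \<phi>)"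
| "sat T V s (AtLeast C x \<phi>) \<longleftrightarrow> card {a \<in> T. sat T V (s(x := a)) \<phi>} \<ge> C"
| "sat T V s (AtMost C x \<phi>) \<longleftrightarrow> card {a \<in> T. sat T V (s(x := a)) \<phi>} \<le> C"


text \<open>In the next two quantifier rules, \<open>x # xs\<close> plays the role of \<open>x\<^sub>0, \<dots>, x\<^sub>k\<close>, which are
  metavariables for arbitrary distinct variables.\<close>

inductive_set F1_fmls :: "'p fo set" where
  atom: "atomic \<phi> \<Longrightarrow> \<phi> \<in> F1_fmls"
| neg: "\<phi> \<in> F1_fmls \<Longrightarrow> Neg \<phi> \<in> F1_fmls"
| disj: "\<phi> \<in> F1_fmls \<Longrightarrow> \<psi> \<in> F1_fmls \<Longrightarrow> Disj \<phi> \<psi> \<in> F1_fmls"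
| ex_all: "\<phi> \<in> F1_fmls \<Longrightarrow> distinct (x # xs) \<Longrightarrow> fv \<phi> \<subseteq> set (x # xs) \<Longrightarrow>
    exs (x # xs) \<phi> \<in> F1_fmls"
| ex_all_but_one: "\<phi> \<in> F1_fmls \<Longrightarrow> distinct (x # xs) \<Longrightarrow> fv \<phi> \<subseteq> set (x # xs) \<Longrightarrow>
    exs xs \<phi> \<in> F1_fmls"

inductive_set UNFO_fmls :: "'p fo set" where
  atom: "atomic \<phi> \<Longrightarrow> \<phi> \<in> UNFO_fmls"
| disj: "\<phi> \<in> UNFO_fmls \<Longrightarrow> \<psi> \<in> UNFO_fmls \<Longrightarrow> Disj \<phi> \<psi> \<in> UNFO_fmls"
| conj: "\<phi> \<in> UNFO_fmls \<Longrightarrow> \<psi> \<in> UNFO_fmls \<Longrightarrow> Conj \<phi> \<psi> \<in> UNFO_fmls"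
| ex: "\<phi> \<in> UNFO_fmls \<Longrightarrow> Ex x \<phi> \<in> UNFO_fmls"
| neg: "\<phi> \<in> UNFO_fmls \<Longrightarrow> card (fv \<phi>) \<le> 1 \<Longrightarrow> Neg \<phi> \<in> UNFO_fmls"

text \<open>The guarded fragment.  As usual, equalities may serve as guards.\<close>

inductive_set GF_fmls :: "'p fo set" where
  atom: "atomic \<phi> \<Longrightarrow> \<phi> \<in> GF_fmls"
| neg: "\<phi> \<in> GF_fmls \<Longrightarrow> Neg \<phi> \<in> GF_fmls"
| conj: "\<phi> \<in> GF_fmls \<Longrightarrow> \<psi> \<in> GF_fmls \<Longrightarrow> Conj \<phi> \<psi> \<in> GF_fmls"
| disj: "\<phi> \<in> GF_fmls \<Longrightarrow> \<psi> \<in> GF_fmls \<Longrightarrow> Disj \<phi> \<psi> \<in> GF_fmls"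
| ex: "\<psi> \<in> GF_fmls \<Longrightarrow> atomic \<alpha> \<Longrightarrow> fv \<psi> \<subseteq> fv \<alpha> \<Longrightarrow> distinct vs \<Longrightarrow>
    exs vs (Conj \<alpha> \<psi>) \<in> GF_fmls"
| all: "\<psi> \<in> GF_fmls \<Longrightarrow> atomic \<alpha> \<Longrightarrow> fv \<psi> \<subseteq> fv \<alpha> \<Longrightarrow> distinct vs \<Longrightarrow>
    alls vs (Imp \<alpha> \<psi>) \<in> GF_fmls"

text \<open>Core XPath.  The nullary connective \<open>XTrue\<close> is included so that there are formulas over
  the signature without unary predicates; otherwise it is definable.\<close>

datatype 'p cxpath =
    XTrue
  | XProp 'p
  | XNot "'p cxpath"
  | XAnd "'p cxpath" "'p cxpath"
  | XOr "'p cxpath" "'p cxpath"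
  | XChild "'p cxpath"
  | XParent "'p cxpath"
  | XDesc "'p cxpath"
  | XAnc "'p cxpath"

text \<open>Standard translation, with free variable \<open>x\<close> and auxiliary variable \<open>y\<close>; the two swap roles
  under a modality.\<close>

fun st :: "nat \<Rightarrow> nat \<Rightarrow> 'p cxpath \<Rightarrow> 'p fo" where
  "st x y XTrue = Equal x x"
| "st x y (XProp p) = Pred p x"
| "st x y (XNot \<phi>) = Neg (st x y \<phi>)"
| "st x y (XAnd \<phi> \<psi>) = Conj (st x y \<phi>) (st x y \<psi>)"
| "st x y (XOr \<phi> \<psi>) = Disj (st x y \<phi>) (st x y \<psi>)"
| "st x y (XChild \<phi>) = Ex y (Conj (Child x y) (st y x \<phi>))"
| "st x y (XParent \<phi>) = Ex y (Conj (Child y x) (st y x \<phi>))"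
| "st x y (XDesc \<phi>) = Ex y (Conj (Desc x y) (st y x \<phi>))"
| "st x y (XAnc \<phi>) = Ex y (Conj (Desc y x) (st y x \<phi>))"


text \<open>The logics over the signature with unary predicates \<open>P\<close>.  The two variables of the
  two-variable logics are \<open>0\<close> and \<open>1\<close>.\<close>

definition CoreXPath :: "'p set \<Rightarrow> 'p fo set" where
  "CoreXPath P = {\<phi> \<in> range (st 0 1). preds \<phi> \<subseteq> P}"

definition GF2 :: "'p set \<Rightarrow> 'p fo set" where
  "GF2 P = {\<phi> \<in> GF_fmls. vars \<phi> \<subseteq> {0, 1} \<and> preds \<phi> \<subseteq> P}"

definition UNFO :: "'p set \<Rightarrow> 'p fo set" where
  "UNFO P = {\<phi> \<in> UNFO_fmls. preds \<phi> \<subseteq> P}"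

definition FO2 :: "'p set \<Rightarrow> 'p fo set" where
  "FO2 P = {\<phi>. counting_free \<phi> \<and> vars \<phi> \<subseteq> {0, 1} \<and> preds \<phi> \<subseteq> P}"

definition C2 :: "'p set \<Rightarrow> 'p fo set" where
  "C2 P = {\<phi>. vars \<phi> \<subseteq> {0, 1} \<and> preds \<phi> \<subseteq> P}"

definition F1 :: "'p set \<Rightarrow> 'p fo set" where
  "F1 P = {\<phi> \<in> F1_fmls. preds \<phi> \<subseteq> P}"


definition one_free :: "'p fo \<Rightarrow> bool" where
  "one_free \<phi> \<longleftrightarrow> (\<exists>x. fv \<phi> = {x})"

text \<open>Truth of a formula with one free variable at an element: whatever the name of the free
  variable is, the constant assignment maps it to \<open>a\<close>.\<close>

definition holds_at :: "nat list set \<Rightarrow> ('p \<Rightarrow> nat list set) \<Rightarrow> nat list \<Rightarrow> 'p fo \<Rightarrow> bool" where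
  "holds_at T V a \<phi> \<longleftrightarrow> sat T V (\<lambda>_. a) \<phi>"

definition tree_equiv :: "'p fo \<Rightarrow> 'p fo \<Rightarrow> bool" where
  "tree_equiv \<phi> \<psi> \<longleftrightarrow>
     (\<forall>T V. finite_tree T V \<longrightarrow> (\<forall>a\<in>T. holds_at T V a \<phi> \<longleftrightarrow> holds_at T V a \<psi>))"

definition expr_le :: "'p fo set \<Rightarrow> 'p fo set \<Rightarrow> bool"  (infix "\<preceq>\<^sub>e" 50) where
  "L1 \<preceq>\<^sub>e L2 \<longleftrightarrow>
     (\<forall>\<phi>\<in>L1. one_free \<phi> \<longrightarrow> (\<exists>\<psi>\<in>L2. one_free \<psi> \<and> tree_equiv \<phi> \<psi>))"

definition expr_eq :: "'p fo set \<Rightarrow> 'p fo set \<Rightarrow> bool"  (infix "\<equiv>\<^sub>e" 50) where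
  "L1 \<equiv>\<^sub>e L2 \<longleftrightarrow> L1 \<preceq>\<^sub>e L2 \<and> L2 \<preceq>\<^sub>e L1"

definition expr_less :: "'p fo set \<Rightarrow> 'p fo set \<Rightarrow> bool"  (infix "\<prec>\<^sub>e" 50) where
  "L1 \<prec>\<^sub>e L2 \<longleftrightarrow> L1 \<preceq>\<^sub>e L2 \<and> \<not> L2 \<preceq>\<^sub>e L1"

end

theory Submission
  imports Defs "HOL-Library.Sublist"
begin

text \<open>Pointed trees are classified by finitely many modal types of each depth, over the four
  modalities child, parent, descendant and ancestor, graded up to some bound.  Every property
  that is invariant under types of some depth is a Boolean combination of types, hence definable in
  CoreXPath if the modalities are not graded, and in \<open>C\<^sup>2\<close> if they are.

  Points of the same ungraded type of sufficient depth allow moving along any atomic relation, which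
  handles \<open>GF\<^sup>2\<close>, and mapping any \<open>k\<close> further nodes homomorphically: the order is a forest, so
  each node only has to be placed correctly relative to the nearest one already placed.  Unary negation
  never requires more than homomorphisms.  The Boolean combinations in \<open>F\<^sub>1\<close> also observe
  incomparability, so here the \<open>k\<close> nodes must be embedded; this needs different branches
  at a node to be sent to different branches, which the grading of the child modality ensures.
  Conversely \<open>F\<^sub>1\<close> can quantify \<open>C\<close> distinct witnesses at once.

  Stars with one and two leaves are bisimilar but distinguished by \<open>FO\<^sup>2\<close>; stars with two and
  three leaves need three pebbles.\<close>

section \<open>Positions in trees\<close>

text \<open>A type speaks about one point, while a quantifier block constrains several nodes at
  once, and the paths between these nodes have no bounded length. The depth of the types must
  nevertheless depend only on the number of nodes. It does, because nodes at or below some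
  \<open>c\<close> and nodes not strictly below \<open>c\<close> interact only through
  \<open>c\<close>: partial maps that agree at \<open>c\<close> can be glued there, and a long path
  is crossed in a constant number of modal steps. So each node placed costs a fixed number of
  levels. Invariance under types is an adequate induction hypothesis for \<open>GF2\<close> and
  \<open>F1\<close>, where negation is unrestricted. For \<open>UNFO\<close> it is not: a formula
  with several free variables is carried by homomorphisms in one direction only. There the induction
  maintains that a true formula has a witness set of bounded size. The bound matters at a negation:
  it fixes in advance a depth at which homomorphisms from the witnesses of the negated formula
  exist.\<close>

lemma descendant_eq: "descendant = strict_prefix"
  by (intro ext) (auto simp: descendant_def strict_prefix_def prefix_def)

lemma strict_prefix_length: "strict_prefix a b \<Longrightarrow> length a < length b"
  by (auto simp: strict_prefix_def prefix_def)

lemma child_strict_prefix: "child a b \<Longrightarrow> strict_prefix a b"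
  by (auto simp: child_def strict_prefix_def)

lemma child_between: "strict_prefix a b \<Longrightarrow> \<exists>c. child a c \<and> prefix c b"
proof -
  assume "strict_prefix a b"
  then obtain x xs where "b = a @ x # xs"
    by (metis strict_prefixE')
  then show ?thesis
    by (intro exI[of _ "a @ [x]"]) (simp add: child_def)
qed

lemma child_no_between: "child a c \<Longrightarrow> strict_prefix d c \<Longrightarrow> prefix d a"
  by (auto simp: child_def strict_prefix_def)

lemma tree_prefix_closed:
  assumes "finite_tree T V" "b \<in> T" "prefix a b"
  shows "a \<in> T"
proof -
  from assms(3) obtain zs where "b = a @ zs" by (auto simp: prefix_def)
  with assms(2) have "a @ zs \<in> T" by simp
  then show ?thesis
  proof (induction zs rule: rev_induct)
    case (snoc x xs)
    then show ?case
      using assms(1) unfolding finite_tree_def by (metis append_assoc)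
  qed simp
qed

lemma tree_root: "finite_tree T V \<Longrightarrow> [] \<in> T"
  using tree_prefix_closed[of T V _ "[]"] by (auto simp: finite_tree_def)

lemma tree_finite: "finite_tree T V \<Longrightarrow> finite T"
  by (simp add: finite_tree_def)

section \<open>Types of pointed trees\<close>

type_synonym 'p pointed = "nat list set \<times> ('p \<Rightarrow> nat list set) \<times> nat list"

text \<open>The graded modality as an operation on properties of pointed trees. Types are built
  semantically, so that one hierarchy serves both target logics.\<close>

fun dia :: "nat \<Rightarrow> (nat list \<Rightarrow> nat list \<Rightarrow> bool) \<Rightarrow> ('p pointed \<Rightarrow> bool) \<Rightarrow> 'p pointed \<Rightarrow> bool" where
  "dia C R f (T, V, a) \<longleftrightarrow> C \<le> card {b \<in> T. R a b \<and> f (T, V, b)}"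

definition rels :: "(nat list \<Rightarrow> nat list \<Rightarrow> bool) set" where
  "rels = {child, child\<inverse>\<inverse>, strict_prefix, strict_prefix\<inverse>\<inverse>}"

definition agree :: "('a \<Rightarrow> bool) set \<Rightarrow> 'a \<Rightarrow> 'a \<Rightarrow> bool" where
  "agree F q r \<longleftrightarrow> (\<forall>f\<in>F. f q \<longleftrightarrow> f r)"

text \<open>Two points have the same type of depth \<open>n\<close> if they agree on all probes of
  level \<open>n\<close>. \<open>G\<close> is constantly 1 for ungraded types and \<open>Suc\<close>
  for graded ones, so in either case the single number \<open>n\<close> controls both nesting depth
  and counting bound. Modalities are applied to complete types of the previous level, each given by
  a representative triple.\<close>

primrec probes :: "'p set \<Rightarrow> (nat \<Rightarrow> nat) \<Rightarrow> nat \<Rightarrow> ('p pointed \<Rightarrow> bool) set" where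
  "probes P G 0 = (\<lambda>p (T, V, a). a \<in> V p) ` P"
| "probes P G (Suc n) = probes P G n \<union>
     (\<lambda>(C, R, f). dia C R f) ` ({1..G n} \<times> rels \<times> range (agree (probes P G n)))"

lemma agreeD: "agree F q r \<Longrightarrow> f \<in> F \<Longrightarrow> f q \<longleftrightarrow> f r"
  by (auto simp: agree_def)

lemma agree_sym: "agree F q r \<Longrightarrow> agree F r q"
  by (auto simp: agree_def)

lemma agree_trans: "agree F q r \<Longrightarrow> agree F r t \<Longrightarrow> agree F q t"
  by (auto simp: agree_def)

lemma probes_mono: "m \<le> n \<Longrightarrow> probes P G m \<subseteq> probes P G n"
  by (rule lift_Suc_mono_le) auto

section \<open>From invariance under types to definability\<close>

locale boolean_closed =
  fixes D :: "('a \<Rightarrow> bool) set"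
  assumes top_closed: "(\<lambda>_. True) \<in> D"
    and not_closed: "f \<in> D \<Longrightarrow> (\<lambda>x. \<not> f x) \<in> D"
    and and_closed: "f \<in> D \<Longrightarrow> g \<in> D \<Longrightarrow> (\<lambda>x. f x \<and> g x) \<in> D"
begin

lemma ball_closed: "finite S \<Longrightarrow> S \<subseteq> D \<Longrightarrow> (\<lambda>x. \<forall>f\<in>S. f x) \<in> D"
  by (induction S rule: finite_induct) (auto simp: top_closed and_closed)

lemma bex_closed:
  assumes "finite S" "S \<subseteq> D"
  shows "(\<lambda>x. \<exists>f\<in>S. f x) \<in> D"
proof -
  have "(\<lambda>x. \<forall>f\<in>(\<lambda>f x. \<not> f x) ` S. f x) \<in> D"
    by (rule ball_closed) (use assms not_closed in auto)
  from not_closed[OF this] show ?thesis by simp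
qed

lemma agree_closed:
  assumes "finite F" "F \<subseteq> D"
  shows "agree F q \<in> D"
proof -
  have "(\<lambda>r. f q \<longleftrightarrow> f r) \<in> D" if "f \<in> F" for f
    using that assms(2) not_closed[of f] by (cases "f q") auto
  then have "(\<lambda>x. \<forall>g\<in>(\<lambda>f r. f q \<longleftrightarrow> f r) ` F. g x) \<in> D"
    by (intro ball_closed) (use assms in auto)
  moreover have "(\<lambda>x. \<forall>g\<in>(\<lambda>f r. f q \<longleftrightarrow> f r) ` F. g x) = agree F q"
    by (auto simp: agree_def fun_eq_iff)
  ultimately show ?thesis by simp
qed

end

text \<open>A type is determined by the subset of \<open>F\<close> that it makes true, so there are
  at most as many types as subsets, although the representatives are infinitely many.\<close>

lemma finite_range_agree:
  assumes "finite F"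
  shows "finite (range (agree F))"
proof -
  have "agree F q \<in> (\<lambda>S r. \<forall>f\<in>F. f \<in> S \<longleftrightarrow> f r) ` Pow F" for q
    by (rule image_eqI[of _ _ "{f \<in> F. f q}"]) (auto simp: agree_def fun_eq_iff)
  then have "range (agree F) \<subseteq> (\<lambda>S r. \<forall>f\<in>F. f \<in> S \<longleftrightarrow> f r) ` Pow F"
    by blast
  then show ?thesis
    using assms by (meson finite_Pow_iff finite_imageI finite_subset)
qed

lemma finite_probes: "finite P \<Longrightarrow> finite (probes P G n)"
  by (induction n) (auto intro!: finite_imageI finite_cartesian_product finite_range_agree simp: rels_def)

text \<open>The interface between types and a target logic: \<open>D\<close> will be the set of
  properties definable in the logic, and \<open>G\<close> says how far its modalities can
  count.\<close>

locale modal_closed = boolean_closed D for D :: "('p pointed \<Rightarrow> bool) set" +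
  fixes P :: "'p set" and G :: "nat \<Rightarrow> nat"
  assumes finite_P: "finite P"
    and prop_closed: "p \<in> P \<Longrightarrow> (\<lambda>(T, V, a). a \<in> V p) \<in> D"
    and dia_closed: "1 \<le> C \<Longrightarrow> C \<le> G n \<Longrightarrow> R \<in> rels \<Longrightarrow> f \<in> D \<Longrightarrow> dia C R f \<in> D"
begin

lemma probes_closed: "probes P G n \<subseteq> D"
proof (induction n)
  case 0
  then show ?case using prop_closed by auto
next
  case (Suc n)
  then have "agree (probes P G n) q \<in> D" for q
    by (intro agree_closed) (auto simp: finite_probes finite_P)
  with Suc show ?case using dia_closed by auto
qed

text \<open>The definition of \<open>f\<close> is the disjunction of the types of all valid points
  satisfying \<open>f\<close>; it is finite because there are finitely many types.\<close>

lemma invariant_definable: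
  assumes "\<And>q r. valid q \<Longrightarrow> valid r \<Longrightarrow> agree (probes P G n) q r \<Longrightarrow> f q \<longleftrightarrow> f r"
  shows "\<exists>g\<in>D. \<forall>r. valid r \<longrightarrow> (g r \<longleftrightarrow> f r)"
proof -
  let ?S = "agree (probes P G n) ` {q. valid q \<and> f q}"
  have "finite ?S"
    using finite_range_agree[OF finite_probes[OF finite_P]] by (rule rev_finite_subset) auto
  moreover have "?S \<subseteq> D"
    using agree_closed[OF finite_probes[OF finite_P] probes_closed] by auto
  ultimately have "(\<lambda>x. \<exists>g\<in>?S. g x) \<in> D"
    by (rule bex_closed)
  moreover have "(\<exists>g\<in>?S. g r) \<longleftrightarrow> f r" if "valid r" for r
  proof
    assume "\<exists>g\<in>?S. g r"
    then show "f r" using assms that by blast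
  next
    assume "f r"
    with that have "agree (probes P G n) r \<in> ?S" by blast
    moreover have "agree (probes P G n) r r" by (simp add: agree_def)
    ultimately show "\<exists>g\<in>?S. g r" by blast
  qed
  ultimately show ?thesis by (intro bexI[of _ "\<lambda>x. \<exists>g\<in>?S. g x"]) blast+
qed

end

section \<open>Back-and-forth between two trees\<close>

text \<open>The atomic type of a pair of nodes, apart from predicates. Both directions are required
  because formulas may negate atoms.\<close>

definition same_pos :: "nat list \<Rightarrow> nat list \<Rightarrow> nat list \<Rightarrow> nat list \<Rightarrow> bool" where
  "same_pos x y x' y' \<longleftrightarrow> (x = y \<longleftrightarrow> x' = y') \<and>
     (child x y \<longleftrightarrow> child x' y') \<and> (child y x \<longleftrightarrow> child y' x') \<and>
     (strict_prefix x y \<longleftrightarrow> strict_prefix x' y') \<and> (strict_prefix y x \<longleftrightarrow> strict_prefix y' x')"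

lemma same_pos_commute: "same_pos x y x' y' \<Longrightarrow> same_pos y x y' x'"
  by (auto simp: same_pos_def)

lemma same_pos_refl: "same_pos x x x' x'"
  by (auto simp: same_pos_def child_def)

lemma same_pos_prefix: "same_pos x y x' y' \<Longrightarrow> prefix x y \<longleftrightarrow> prefix x' y'"
  by (auto simp: same_pos_def prefix_order.le_less)

lemma same_pos_child: "child x y \<Longrightarrow> child x' y' \<Longrightarrow> same_pos x y x' y'"
  unfolding same_pos_def
  using child_strict_prefix prefix_order.less_asym prefix_order.less_irrefl by metis

text \<open>The intermediate child certifies that \<open>y\<close> is a descendant but not a child
  of \<open>x\<close>.\<close>

lemma same_pos_grandchild:
  assumes "child x c" "strict_prefix c y" "child x' c'" "strict_prefix c' y'"
  shows "same_pos x y x' y'"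
proof -
  have "strict_prefix x y \<and> \<not> child x y" if "child x c" "strict_prefix c y" for x c y :: "nat list"
    using that by (meson child_no_between child_strict_prefix prefix_order.leD prefix_order.less_trans)
  with assms show ?thesis
    unfolding same_pos_def
    using child_strict_prefix prefix_order.less_asym prefix_order.less_irrefl by metis
qed

lemma card_ne_0: "finite A \<Longrightarrow> x \<in> A \<Longrightarrow> card A \<noteq> 0"
  by auto

lemma card_ne_0D: "card A \<noteq> 0 \<Longrightarrow> \<exists>x. x \<in> A"
  by (cases "A = {}") auto

locale tree_pair =
  fixes P :: "'p set" and G :: "nat \<Rightarrow> nat"
    and T :: "nat list set" and V :: "'p \<Rightarrow> nat list set"
    and T' :: "nat list set" and V' :: "'p \<Rightarrow> nat list set"
  assumes tree: "finite_tree T V" and tree': "finite_tree T' V'"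
    and G_pos: "1 \<le> G n"
begin

definition sim :: "nat \<Rightarrow> nat list \<Rightarrow> nat list \<Rightarrow> bool" where
  "sim n a a' \<longleftrightarrow> agree (probes P G n) (T, V, a) (T', V', a')"

lemma sim_mono: "sim n a a' \<Longrightarrow> m \<le> n \<Longrightarrow> sim m a a'"
  using probes_mono[of m n P G] by (auto simp: sim_def agree_def)

lemma sim_prop:
  assumes "sim n a a'" "p \<in> P"
  shows "a \<in> V p \<longleftrightarrow> a' \<in> V' p"
  using sim_mono[OF assms(1), of 0] assms(2) by (auto simp: sim_def agree_def)

lemma sim_dia:
  assumes "sim (Suc n) a a'" "R \<in> rels" "1 \<le> C" "C \<le> G n"
  shows "C \<le> card {x \<in> T. R a x \<and> agree (probes P G n) q (T, V, x)} \<longleftrightarrow>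
    C \<le> card {x \<in> T'. R a' x \<and> agree (probes P G n) q (T', V', x)}"
proof -
  have "dia C R (agree (probes P G n) q) \<in> probes P G (Suc n)"
    using assms by (auto intro!: image_eqI[of _ _ "(C, R, agree (probes P G n) q)"])
  from agreeD[OF assms(1)[unfolded sim_def] this] show ?thesis by simp
qed

lemma sim_step:
  assumes "sim (Suc n) a a'" "R \<in> rels" "b \<in> T" "R a b"
  shows "\<exists>b'\<in>T'. R a' b' \<and> sim n b b'"
proof -
  let ?S = "{x \<in> T. R a x \<and> agree (probes P G n) (T, V, b) (T, V, x)}"
  let ?S' = "{x \<in> T'. R a' x \<and> agree (probes P G n) (T, V, b) (T', V', x)}"
  have "finite ?S"
    using tree_finite[OF tree] by simp
  moreover have "b \<in> ?S"
    using assms(3,4) by (simp add: agree_def)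
  ultimately have "card ?S \<noteq> 0"
    by (rule card_ne_0)
  then have "1 \<le> card ?S" by linarith
  then have "1 \<le> card ?S'"
    using sim_dia[OF assms(1,2) _ G_pos, of "(T, V, b)"] by linarith
  then have "card ?S' \<noteq> 0" by linarith
  then show ?thesis
    using card_ne_0D[of ?S'] by (auto simp: sim_def)
qed

lemma sim_step_down:
  assumes "sim (Suc n) a a'" "b \<in> T" "strict_prefix a b"
  shows "\<exists>b'\<in>T'. strict_prefix a' b' \<and> (child a b \<longrightarrow> child a' b') \<and> sim n b b'"
  using sim_step[OF assms(1) _ assms(2), of child] sim_step[OF assms(1) _ assms(2), of strict_prefix]
    assms(3) child_strict_prefix unfolding rels_def by blast

lemma sim_step_up:
  assumes "sim (Suc n) a a'" "b \<in> T" "strict_prefix b a"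
  shows "\<exists>b'\<in>T'. strict_prefix b' a' \<and> (child b a \<longrightarrow> child b' a') \<and> sim n b b'"
  using sim_step[OF assms(1) _ assms(2), of "child\<inverse>\<inverse>"]
    sim_step[OF assms(1) _ assms(2), of "strict_prefix\<inverse>\<inverse>"]
    assms(3) child_strict_prefix unfolding rels_def by blast

text \<open>A direct step along the descendant relation might land on a child where \<open>v\<close>
  is none. Moving first to the child of \<open>u\<close> on the path and then strictly below it
  excludes this, at the price of two levels.\<close>

lemma jump_down:
  assumes "sim (n + 2) u u'" "u' \<in> T'" "v \<in> T" "prefix u v"
  shows "\<exists>v'\<in>T'. sim n v v' \<and> same_pos u v u' v'"
proof (cases "u = v")
  case True
  then show ?thesis
    using assms sim_mono[OF assms(1), of n] same_pos_refl by auto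
next
  case False
  then obtain c where c: "child u c" "prefix c v"
    using assms(4) child_between by (metis prefix_order.le_neq_trans)
  then have "c \<in> T" using tree_prefix_closed[OF tree assms(3)] by auto
  then obtain c' where c': "c' \<in> T'" "child u' c'" "sim (Suc n) c c'"
    using sim_step[of "Suc n" u u' child c] assms(1) c(1) by (auto simp: rels_def)
  show ?thesis
  proof (cases "c = v")
    case True
    then show ?thesis using c c' same_pos_child sim_mono[OF c'(3), of n] by auto
  next
    case False
    then have "strict_prefix c v" using c(2) by auto
    then obtain v' where "v' \<in> T'" "strict_prefix c' v'" "sim n v v'"
      using sim_step_down[OF c'(3) assms(3)] by blast
    then show ?thesis
      using same_pos_grandchild c(1) c'(2) \<open>strict_prefix c v\<close> by blast
  qed
qed

text \<open>The same detour as for descending, in reverse: climb to the child of \<open>v\<close> on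
  the path, then take its parent.\<close>

lemma jump_up:
  assumes "sim (n + 2) u u'" "u \<in> T" "u' \<in> T'" "prefix v u"
  shows "\<exists>v'\<in>T'. sim n v v' \<and> same_pos u v u' v'"
proof (cases "u = v")
  case True
  then show ?thesis
    using assms sim_mono[OF assms(1), of n] same_pos_refl by auto
next
  case False
  then obtain c where c: "child v c" "prefix c u"
    using assms(4) child_between by (metis prefix_order.le_neq_trans)
  have T: "c \<in> T" "v \<in> T"
    using tree_prefix_closed[OF tree assms(2)] assms(4) c(2) by auto
  show ?thesis
  proof (cases "c = u")
    case True
    obtain v' where "v' \<in> T'" "child v' u'" "sim (Suc n) v v'"
      using sim_step[of "Suc n" u u' "child\<inverse>\<inverse>" v] assms(1) c(1) T True by (auto simp: rels_def)
    moreover from this have "same_pos u v u' v'"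
      using c(1) True by (intro same_pos_commute[OF same_pos_child]) auto
    moreover have "sim n v v'"
      using \<open>sim (Suc n) v v'\<close> by (rule sim_mono) simp
    ultimately show ?thesis by blast
  next
    case False
    then have *: "strict_prefix c u" using c(2) by auto
    then obtain c' where c': "c' \<in> T'" "strict_prefix c' u'" "sim (Suc n) c c'"
      using sim_step_up[of "Suc n" u u' c] assms(1) T by auto
    then obtain v' where "v' \<in> T'" "child v' c'" "sim n v v'"
      using sim_step[of n c c' "child\<inverse>\<inverse>" v] c(1) T by (auto simp: rels_def)
    then show ?thesis
      using same_pos_commute[OF same_pos_grandchild[OF c(1) * _ c'(2)]] by blast
  qed
qed

text \<open>Any two nodes are connected via the root, by one step up and one step down. The partner
  \<open>e'\<close> of the root only needs the right type.\<close>

lemma jump_any: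
  assumes "sim (n + 2) r r'" "r \<in> T" "r' \<in> T'" "b \<in> T"
  shows "\<exists>b'\<in>T'. sim n b b'"
proof -
  have root: "\<exists>e'\<in>T'. sim (Suc n) [] e'"
  proof (cases "r = []")
    case True
    then show ?thesis using assms sim_mono[OF assms(1), of "Suc n"] by auto
  next
    case False
    then show ?thesis
      using sim_step_up[of "Suc n" r r' "[]"] assms tree_root[OF tree]
      by (auto simp: prefix_order.less_le)
  qed
  then obtain e' where e': "e' \<in> T'" "sim (Suc n) [] e'" by blast
  show ?thesis
  proof (cases "b = []")
    case True
    then show ?thesis using e' sim_mono[OF e'(2), of n] by auto
  next
    case False
    then have "strict_prefix [] b" by (simp add: prefix_order.less_le)
    then show ?thesis using sim_step_down[OF e'(2) assms(4)] by blast
  qed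
qed

text \<open>Counting within the type of \<open>c\<close>: including \<open>c\<close> itself,
  \<open>u\<close> has more children of this type than \<open>C\<close> contains, hence so has
  \<open>u'\<close>, and one of them is not an image. Members of \<open>C\<close> of other types
  cannot interfere since \<open>g\<close> preserves types.\<close>

lemma sim_fresh_child:
  assumes "sim (Suc n) u u'" "card C + 1 \<le> G n" "finite C"
    and C: "\<And>x. x \<in> C \<Longrightarrow> x \<in> T \<and> child u x \<and> g x \<in> T' \<and> child u' (g x) \<and> sim n x (g x)"
    and "inj_on g C" "c \<in> T" "child u c" "c \<notin> C"
  shows "\<exists>c'\<in>T'. child u' c' \<and> c' \<notin> g ` C \<and> sim n c c'"
proof -
  let ?A = "agree (probes P G n) (T, V, c)"
  let ?S = "{x \<in> C. ?A (T, V, x)}"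
  let ?B = "{x \<in> T'. child u' x \<and> ?A (T', V', x)}"
  have "card (insert c ?S) \<le> card {x \<in> T. child u x \<and> ?A (T, V, x)}"
    by (intro card_mono) (use assms(6,7) C tree_finite[OF tree] in \<open>auto simp: agree_def\<close>)
  then have 1: "Suc (card ?S) \<le> card {x \<in> T. child u x \<and> ?A (T, V, x)}"
    using assms(3,8) by simp
  have "card ?S \<le> card C"
    by (intro card_mono) (use assms(3) in auto)
  then have "Suc (card ?S) \<le> card ?B"
    using 1 sim_dia[OF assms(1), of child "Suc (card ?S)" "(T, V, c)"] assms(2)
    by (simp add: rels_def)
  moreover have "card (g ` ?S) \<le> card ?S"
    by (intro card_image_le) (use assms(3) in auto)
  ultimately have "\<not> ?B \<subseteq> g ` ?S"
    using card_mono[of "g ` ?S" ?B] assms(3) by auto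
  then obtain c' where c': "c' \<in> T'" "child u' c'" "?A (T', V', c')" "c' \<notin> g ` ?S" by blast
  have "c' \<notin> g ` C"
  proof
    assume "c' \<in> g ` C"
    then obtain x where x: "x \<in> C" "c' = g x" by blast
    then have "sim n x c'" using C by simp
    then have "?A (T, V, x)"
      using agree_trans[OF c'(3) agree_sym] by (simp add: sim_def)
    then have "x \<in> ?S" using x by simp
    then show False using x(2) c'(4) by simp
  qed
  with c' show ?thesis by (auto simp: sim_def)
qed

text \<open>Equality and incomparability are reflected too, so such a map is injective on
  \<open>D\<close>.\<close>

definition embedding :: "nat \<Rightarrow> (nat list \<Rightarrow> nat list) \<Rightarrow> nat list set \<Rightarrow> bool" where
  "embedding n h D \<longleftrightarrow> (\<forall>x\<in>D. x \<in> T \<and> h x \<in> T' \<and> sim n x (h x)) \<and>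
     (\<forall>x\<in>D. \<forall>y\<in>D. same_pos x y (h x) (h y))"

lemma embedding_subset: "embedding n h D \<Longrightarrow> E \<subseteq> D \<Longrightarrow> embedding n h E"
  unfolding embedding_def by blast

lemma embedding_mono: "embedding n h D \<Longrightarrow> m \<le> n \<Longrightarrow> embedding m h D"
  using sim_mono unfolding embedding_def by blast

lemma embedding_edge:
  assumes "sim n a a'" "sim n b b'" "a \<in> T" "b \<in> T" "a' \<in> T'" "b' \<in> T'" "same_pos a b a' b'"
  shows "\<exists>h. embedding n h {a, b} \<and> h a = a' \<and> h b = b'"
proof -
  let ?h = "(\<lambda>_. b')(a := a')"
  have *: "?h a = a'" "?h b = b'" using assms(7) by (auto simp: same_pos_def)
  then have "embedding n ?h {a, b}"
    using assms same_pos_commute[OF assms(7)] same_pos_refl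
    unfolding embedding_def by (auto simp del: fun_upd_apply)
  with * show ?thesis by blast
qed

text \<open>Positions on different sides of \<open>c\<close> are related only through \<open>c\<close>.\<close>

lemma same_pos_through:
  assumes "\<not> strict_prefix c a" "prefix c b" "same_pos c a c' a'" "same_pos c b c' b'"
  shows "same_pos a b a' b'"
proof -
  have *: "(a = b \<longleftrightarrow> a = c \<and> b = c) \<and> (child a b \<longleftrightarrow> child a c \<and> b = c \<or> a = c \<and> child c b) \<and>
      \<not> child b a \<and> (strict_prefix a b \<longleftrightarrow> strict_prefix a c \<or> a = c \<and> strict_prefix c b) \<and>
      \<not> strict_prefix b a"
    if ca: "\<not> strict_prefix c a" and cb: "prefix c b" for a b c :: "nat list"
  proof (cases "b = c")
    case True
    then show ?thesis using ca child_strict_prefix prefix_order.less_irrefl by blast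
  next
    case False
    with cb have sb: "strict_prefix c b" by (simp add: prefix_order.less_le)
    have "strict_prefix a c \<or> a = c" if "strict_prefix a b"
      using that cb ca prefix_same_cases[of a b c] by (auto simp: prefix_order.less_le)
    moreover have "strict_prefix a b" if "strict_prefix a c"
      using that sb by (rule prefix_order.less_trans)
    moreover have "a = c" if "child a b"
      using child_no_between[OF that sb] ca by (auto simp: prefix_order.less_le)
    moreover have "\<not> strict_prefix b a"
      using sb ca prefix_order.less_trans by blast
    moreover have "a \<noteq> b" using sb ca by blast
    ultimately show ?thesis using sb False child_strict_prefix by blast
  qed
  have "\<not> strict_prefix c' a'" "prefix c' b'"
    using same_pos_prefix[OF assms(4)] assms(1-3) by (simp_all add: same_pos_def)
  note * = *[OF this] *[OF assms(1,2)]
  have "a = c \<longleftrightarrow> a' = c'" "b = c \<longleftrightarrow> b' = c'"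
    using assms(3,4) by (auto simp: same_pos_def)
  with * assms(3,4) show ?thesis
    unfolding same_pos_def by simp
qed

text \<open>The two side conditions force \<open>A\<close> and \<open>B\<close> to meet in
  \<open>c\<close> only, so the maps are compatible; positions across the two parts are determined
  through \<open>c\<close>.\<close>

lemma embedding_glue:
  assumes "embedding n h A" "embedding n k B" "c \<in> A" "c \<in> B" "h c = k c"
    and "\<And>a. a \<in> A \<Longrightarrow> \<not> strict_prefix c a" "\<And>b. b \<in> B \<Longrightarrow> prefix c b"
  shows "\<exists>f. embedding n f (A \<union> B) \<and> (\<forall>a\<in>A. f a = h a) \<and> (\<forall>b\<in>B. f b = k b)"
proof -
  define f where "f = (\<lambda>x. if x \<in> A then h x else k x)"
  have A: "f a = h a" if "a \<in> A" for a using that by (simp add: f_def)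
  have "b = c" if "b \<in> A" "b \<in> B" for b
    using assms(6)[OF that(1)] assms(7)[OF that(2)] by (auto simp: prefix_order.le_less)
  then have B: "f b = k b" if "b \<in> B" for b
    using that assms(5) by (auto simp: f_def)
  have AB: "same_pos a b (f a) (f b)" if "a \<in> A" "b \<in> B" for a b
  proof (rule same_pos_through[OF assms(6)[OF that(1)] assms(7)[OF that(2)]])
    show "same_pos c a (h c) (f a)"
      using assms(1,3) that(1) A unfolding embedding_def by simp
    show "same_pos c b (h c) (f b)"
      using assms(2,4,5) that(2) B unfolding embedding_def by simp
  qed
  have "same_pos x y (f x) (f y)" if "x \<in> A \<union> B" "y \<in> A \<union> B" for x y
    using that
  proof (elim UnE)
    assume "x \<in> A" "y \<in> A"
    then show ?thesis using assms(1) A unfolding embedding_def by simp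
  next
    assume "x \<in> B" "y \<in> B"
    then show ?thesis using assms(2) B unfolding embedding_def by simp
  qed (use AB same_pos_commute in blast)+
  moreover have "x \<in> T \<and> f x \<in> T' \<and> sim n x (f x)" if "x \<in> A \<union> B" for x
    using that assms(1,2) A B unfolding embedding_def by auto
  ultimately have "embedding n f (A \<union> B)"
    unfolding embedding_def by blast
  with A B show ?thesis by blast
qed

end

section \<open>Embedding finitely many nodes under graded types\<close>

lemma child_not_below: "child u c \<Longrightarrow> \<not> strict_prefix c u"
  using child_strict_prefix prefix_order.less_asym by blast

lemma siblings_incomparable: "child u c \<Longrightarrow> child u d \<Longrightarrow> \<not> strict_prefix c d"
  using child_no_between[of u d c] child_strict_prefix[of u c] prefix_order.leD by blast

lemma same_pos_siblings:
  assumes "child u c" "child u d" "child u' c'" "child u' d'" "c = d \<longleftrightarrow> c' = d'"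
  shows "same_pos c d c' d'"
proof -
  have "\<not> strict_prefix c d" "\<not> strict_prefix d c" "\<not> strict_prefix c' d'" "\<not> strict_prefix d' c'"
    using assms siblings_incomparable by simp_all
  then show ?thesis
    unfolding same_pos_def using child_strict_prefix assms(5) by auto
qed

text \<open>All candidates are prefixes of one sequence \<open>x\<close>, which bounds their
  length.\<close>

lemma ex_longest:
  assumes "Q m" "\<And>y. Q y \<Longrightarrow> prefix y x"
  shows "\<exists>m. Q m \<and> (\<forall>y. Q y \<longrightarrow> length y \<le> length m)"
  by (rule ex_has_greatest_nat[of Q m length "Suc (length x)"]) (simp_all add: assms prefix_length_le le_imp_less_Suc)

locale graded_pair = tree_pair P Suc T V T' V' for P :: "'p set" and T V T' V'
begin

text \<open>Distinct children of one node are always incomparable, so injectivity of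
  \<open>g\<close> settles all positions among them.\<close>

lemma embedding_star:
  assumes "sim n u u'" "u \<in> T" "u' \<in> T'"
    and C: "\<And>c. c \<in> C \<Longrightarrow> c \<in> T \<and> child u c \<and> g c \<in> T' \<and> child u' (g c) \<and> sim n c (g c)"
    and "inj_on g C"
  shows "\<exists>h. embedding n h (insert u C) \<and> h u = u' \<and> (\<forall>c\<in>C. h c = g c)"
proof -
  define h where "h = g(u := u')"
  have "u \<notin> C" using C[of u] by (auto simp: child_def)
  then have h: "h u = u'" "\<And>c. c \<in> C \<Longrightarrow> h c = g c" by (auto simp: h_def)
  have uc: "same_pos u c (h u) (h c)" if "c \<in> C" for c
    using C[OF that] h that same_pos_child by simp
  have cd: "same_pos c d (h c) (h d)" if "c \<in> C" "d \<in> C" for c d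
  proof (rule same_pos_siblings)
    show "child u c" "child u d" "child u' (h c)" "child u' (h d)"
      using C that h by simp_all
    show "c = d \<longleftrightarrow> h c = h d"
      using that h \<open>inj_on g C\<close> by (auto dest: inj_onD)
  qed
  have "embedding n h (insert u C)"
    unfolding embedding_def
    using uc cd same_pos_commute[OF uc] same_pos_refl C h assms(1-3) by simp
  with h show ?thesis by blast
qed

text \<open>\<open>C\<close> holds children of \<open>u\<close> whose branches are already taken,
  with images \<open>g\<close>; the nodes of \<open>X\<close> have to go to other branches. A node
  costs four levels: one to choose a fresh child, two to jump to the branching point below it, one
  for a fresh child there. Whenever the induction hypothesis is used with one more branch taken,
  \<open>k\<close> has dropped by one, so \<open>card C + k\<close> stays within the grading bound
  \<open>Suc n\<close>.\<close>

lemma embed_down: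
  assumes "sim (n + 4 * k) u u'" "u \<in> T" "u' \<in> T'"
    and "\<And>c. c \<in> C \<Longrightarrow> c \<in> T \<and> child u c \<and> g c \<in> T' \<and> child u' (g c) \<and> sim (n + 4 * k) c (g c)"
    and "inj_on g C" "finite C" "card C + k \<le> Suc n"
    and "X \<subseteq> T" "card X \<le> k" "\<And>x. x \<in> X \<Longrightarrow> prefix u x"
    and "\<And>x c. x \<in> X \<Longrightarrow> c \<in> C \<Longrightarrow> \<not> prefix c x"
  shows "\<exists>h. embedding n h (insert u (C \<union> X)) \<and> h u = u' \<and> (\<forall>c\<in>C. h c = g c)"
  using assms
proof (induction k arbitrary: u u' C g X)
  case 0
  then have "X = {}" using tree_finite[OF tree] finite_subset by fastforce
  then show ?case
    using embedding_star[of n u u' C g] 0 by simp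
next
  case (Suc k)
  have fin: "finite Y" if "Y \<subseteq> T" for Y
    using that tree_finite[OF tree] finite_subset by blast
  have fresh: "\<exists>c'\<in>T'. child u' c' \<and> c' \<notin> g ` C \<and> sim m c c'"
    if "sim (Suc m) u u'" "n \<le> m" "c \<in> T" "child u c" "c \<notin> C" "finite C" "card C + Suc k \<le> Suc n"
      "\<And>c. c \<in> C \<Longrightarrow> c \<in> T \<and> child u c \<and> g c \<in> T' \<and> child u' (g c) \<and> sim m c (g c)"
      "inj_on g C" for m u u' C g c
    by (rule sim_fresh_child) (use that in auto)
  \<comment> \<open>Branching at \<open>u\<close>: some but not all of \<open>X\<close> lie below
    the child \<open>c\<close>, so both parts are smaller than \<open>X\<close>. The outer part is
    embedded at \<open>u\<close> with \<open>c\<close> added to the taken branches, the inner part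
    at \<open>c\<close> with none taken, and the maps are glued at \<open>c\<close>.\<close>
  have split: "\<exists>h. embedding n h (insert u (C \<union> X)) \<and> h u = u' \<and> (\<forall>c\<in>C. h c = g c)"
    if u: "sim (Suc (n + 4 * k)) u u'" "u \<in> T" "u' \<in> T'"
      and C: "\<And>c. c \<in> C \<Longrightarrow> c \<in> T \<and> child u c \<and> g c \<in> T' \<and> child u' (g c) \<and> sim (n + 4 * k) c (g c)"
      and g: "inj_on g C" "finite C" "card C + Suc k \<le> Suc n"
      and X: "X \<subseteq> T" "card X \<le> Suc k" "\<And>x. x \<in> X \<Longrightarrow> prefix u x"
      and XC: "\<And>x c. x \<in> X \<Longrightarrow> c \<in> C \<Longrightarrow> \<not> prefix c x"
      and c: "x \<in> X" "child u c" "prefix c x" "y \<in> X" "\<not> prefix c y"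
    for u u' C g X x y c
  proof -
    let ?Xc = "{z \<in> X. prefix c z}"
    have "card ?Xc < card X" "card (X - ?Xc) < card X"
      using c by (intro psubset_card_mono fin X(1); blast)+
    then have card: "card ?Xc \<le> k" "card (X - ?Xc) \<le> k" using X(2) by auto
    have "c \<notin> C" "c \<in> T" using XC c X(1) tree_prefix_closed[OF tree] by auto
    then obtain c' where c': "c' \<in> T'" "child u' c'" "c' \<notin> g ` C" "sim (n + 4 * k) c c'"
      using fresh[of "n + 4 * k" u u' c C g] u C g c(2) by auto
    have "\<exists>h. embedding n h (insert u (insert c C \<union> (X - ?Xc))) \<and> h u = u' \<and>
        (\<forall>d\<in>insert c C. h d = (g(c := c')) d)"
    proof (rule Suc.IH)
      show "sim (n + 4 * k) u u'" using sim_mono[OF u(1)] by simp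
      show "d \<in> T \<and> child u d \<and> (g(c := c')) d \<in> T' \<and> child u' ((g(c := c')) d) \<and>
          sim (n + 4 * k) d ((g(c := c')) d)" if "d \<in> insert c C" for d
        using that C c' c(2) \<open>c \<in> T\<close> by auto
      show "inj_on (g(c := c')) (insert c C)"
        using g(1) c'(3) \<open>c \<notin> C\<close> by (auto simp: inj_on_def)
      show "card (insert c C) + k \<le> Suc n" using g \<open>c \<notin> C\<close> by simp
    qed (use u g X XC card in auto)
    then obtain h1 where h1: "embedding n h1 (insert u (insert c C \<union> (X - ?Xc)))" "h1 u = u'"
      and "\<forall>d\<in>insert c C. h1 d = (g(c := c')) d"
      by blast
    from this(3) \<open>c \<notin> C\<close> have h1': "h1 c = c'" "\<And>d. d \<in> C \<Longrightarrow> h1 d = g d"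
      by fastforce+
    have "\<exists>h. embedding n h (insert c ({} \<union> ?Xc)) \<and> h c = c' \<and> (\<forall>d\<in>{}. h d = g d)"
      by (rule Suc.IH) (use c' \<open>c \<in> T\<close> X(1) card g in auto)
    then obtain h2 where h2: "embedding n h2 (insert c ?Xc)" "h2 c = c'" by auto
    have "\<not> strict_prefix c d" if "d \<in> insert u (insert c C \<union> (X - ?Xc))" for d
      using that C child_not_below[OF c(2)] siblings_incomparable[OF c(2)]
      by (auto dest: prefix_order.less_imp_le)
    then have "\<exists>f. embedding n f (insert u (insert c C \<union> (X - ?Xc)) \<union> insert c ?Xc) \<and>
        (\<forall>a\<in>insert u (insert c C \<union> (X - ?Xc)). f a = h1 a) \<and> (\<forall>b\<in>insert c ?Xc. f b = h2 b)"
      by (intro embedding_glue[OF h1(1) h2(1), of c]) (auto simp: h1' h2)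
    then obtain f where "embedding n f (insert u (insert c C \<union> (X - ?Xc)) \<union> insert c ?Xc)"
      "\<forall>a\<in>insert u (insert c C \<union> (X - ?Xc)). f a = h1 a" by blast
    then have "embedding n f (insert u (C \<union> X)) \<and> f u = u' \<and> (\<forall>c\<in>C. f c = g c)"
      using h1(2) h1'(2) by (intro conjI; (elim embedding_subset)?) auto
    then show ?thesis by blast
  qed
  show ?case
  proof (cases "u \<in> X \<or> X = {}")
    case True
    \<comment> \<open>The node \<open>u\<close> is placed anyway, so removing it from
      \<open>X\<close> frees one unit of \<open>k\<close>.\<close>
    then have "card (X - {u}) \<le> k" using Suc.prems(8,9) fin by fastforce
    then have "\<exists>h. embedding n h (insert u (C \<union> (X - {u}))) \<and> h u = u' \<and> (\<forall>c\<in>C. h c = g c)"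
    proof (intro Suc.IH)
      show "sim (n + 4 * k) u u'" using sim_mono[OF Suc.prems(1)] by simp
      show "c \<in> T \<and> child u c \<and> g c \<in> T' \<and> child u' (g c) \<and> sim (n + 4 * k) c (g c)"
        if "c \<in> C" for c
        using Suc.prems(4)[OF that] sim_mono[of "n + 4 * Suc k" c "g c"] by simp
    qed (use Suc.prems in auto)
    moreover have "insert u (C \<union> (X - {u})) = insert u (C \<union> X)" by blast
    ultimately show ?thesis by simp
  next
    case False
    then obtain x where x: "x \<in> X" "strict_prefix u x"
      using Suc.prems(10) by (auto simp: prefix_order.less_le)
    then obtain c where c: "child u c" "prefix c x" using child_between by blast
    have C: "d \<in> T \<and> child u d \<and> g d \<in> T' \<and> child u' (g d) \<and> sim (n + 4 * k + 3) d (g d)"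
      if "d \<in> C" for d
      using Suc.prems(4)[OF that] sim_mono[of "n + 4 * Suc k" d "g d" "n + 4 * k + 3"] by simp
    have u: "sim (Suc (n + 4 * k + 3)) u u'" using Suc.prems(1) by (simp add: algebra_simps)
    show ?thesis
    proof (cases "\<forall>y\<in>X. prefix c y")
      case False
      then obtain y where y: "y \<in> X" "\<not> prefix c y" by blast
      show ?thesis
        using split[OF _ Suc.prems(2,3) _ Suc.prems(5-8) _ Suc.prems(10,11) x(1) c y]
          sim_mono[OF u, of "Suc (n + 4 * k)"] C sim_mono[of "n + 4 * k + 3" _ _ "n + 4 * k"] Suc.prems(9)
        by simp
    next
      case True
      let ?Q = "\<lambda>m. prefix c m \<and> (\<forall>y\<in>X. prefix m y)"
      obtain m where m: "?Q m" and max: "\<And>y. ?Q y \<Longrightarrow> length y \<le> length m"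
        using ex_longest[of ?Q c x] True x(1) by auto
      have T: "c \<in> T" "m \<in> T"
        using tree_prefix_closed[OF tree] x(1) Suc.prems(8) c(2) m by blast+
      have "c \<notin> C" using Suc.prems(11)[OF x(1)] c(2) by blast
      then obtain c' where c': "c' \<in> T'" "child u' c'" "c' \<notin> g ` C" "sim (n + 4 * k + 3) c c'"
        using fresh[OF u _ T(1) c(1) _ Suc.prems(6,7) C Suc.prems(5)] by auto
      have "sim (Suc (n + 4 * k) + 2) c c'" using sim_mono[OF c'(4)] by simp
      then obtain m' where m': "m' \<in> T'" "sim (Suc (n + 4 * k)) m m'" "same_pos c m c' m'"
        using jump_down[of "Suc (n + 4 * k)" c c' m] c'(1) T(2) m by blast
      have "\<exists>h. embedding n h (insert m ({} \<union> X)) \<and> h m = m' \<and> (\<forall>d\<in>{}. h d = g d)"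
      proof (cases "m \<in> X")
        case True
        then have card: "card (X - {m}) \<le> k" using Suc.prems(8,9) fin by fastforce
        have "\<exists>h. embedding n h (insert m ({} \<union> (X - {m}))) \<and> h m = m' \<and> (\<forall>d\<in>{}. h d = g d)"
          by (rule Suc.IH) (use m' m T Suc.prems card sim_mono[OF m'(2), of "n + 4 * k"] in auto)
        then show ?thesis by simp
      next
        case False
        then have "strict_prefix m x" using m x(1) by (auto simp: prefix_order.less_le)
        then obtain d where d: "child m d" "prefix d x" using child_between by blast
        then have "strict_prefix m d" by (simp add: child_strict_prefix)
        then have "\<not> ?Q d" using max[of d] strict_prefix_length by fastforce
        moreover have "prefix c d"
          using m \<open>strict_prefix m d\<close> prefix_order.le_less_trans prefix_order.less_imp_le by blast
        ultimately obtain y where y: "y \<in> X" "\<not> prefix d y" by blast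
        show ?thesis
          by (rule split[OF m'(2) T(2) m'(1) _ _ _ _ Suc.prems(8,9) _ _ x(1) d y])
            (use m Suc.prems(7) in auto)
      qed
      then obtain h3 where h3: "embedding n h3 (insert m X)" "h3 m = m'" by auto
      have "sim n c c'" "sim n m m'"
        using sim_mono[OF c'(4)] sim_mono[OF m'(2)] by simp_all
      then obtain e where e: "embedding n e {c, m}" "e c = c'" "e m = m'"
        using embedding_edge m' c' T by blast
      have "\<exists>f. embedding n f ({c, m} \<union> insert m X) \<and>
          (\<forall>a\<in>{c, m}. f a = e a) \<and> (\<forall>b\<in>insert m X. f b = h3 b)"
        by (intro embedding_glue[OF e(1) h3(1), of m]) (use e h3 m prefix_order.leD in auto)
      then obtain h4 where h4: "embedding n h4 ({c, m} \<union> insert m X)" "h4 c = c'"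
        using e by auto
      have "\<exists>h. embedding n h (insert u (insert c C)) \<and> h u = u' \<and>
          (\<forall>d\<in>insert c C. h d = (g(c := c')) d)"
      proof (rule embedding_star)
        show "inj_on (g(c := c')) (insert c C)"
          using Suc.prems(5) c'(3) \<open>c \<notin> C\<close> by (auto simp: inj_on_def)
        show "d \<in> T \<and> child u d \<and> (g(c := c')) d \<in> T' \<and> child u' ((g(c := c')) d) \<and>
            sim n d ((g(c := c')) d)" if "d \<in> insert c C" for d
          using that C[of d] c' c(1) T(1) \<open>sim n c c'\<close> sim_mono[of "n + 4 * k + 3" d "g d" n] by auto
      qed (use Suc.prems sim_mono in auto)
      then obtain h5 where h5: "embedding n h5 (insert u (insert c C))" "h5 u = u'"
        and "\<forall>d\<in>insert c C. h5 d = (g(c := c')) d"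
        by blast
      from this(3) \<open>c \<notin> C\<close> have h5': "h5 c = c'" "\<And>d. d \<in> C \<Longrightarrow> h5 d = g d"
        by fastforce+
      have "\<not> strict_prefix c d" if "d \<in> insert u (insert c C)" for d
        using that C child_not_below[OF c(1)] siblings_incomparable[OF c(1)] by auto
      moreover have "prefix c d" if "d \<in> {c, m} \<union> insert m X" for d
        using that m True by auto
      ultimately have "\<exists>f. embedding n f (insert u (insert c C) \<union> ({c, m} \<union> insert m X)) \<and>
          (\<forall>a\<in>insert u (insert c C). f a = h5 a) \<and> (\<forall>b\<in>{c, m} \<union> insert m X. f b = h4 b)"
        by (intro embedding_glue[OF h5(1) h4(1), of c]) (auto simp: h5' h4)
      then obtain f where "embedding n f (insert u (insert c C) \<union> ({c, m} \<union> insert m X))"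
        "\<forall>a\<in>insert u (insert c C). f a = h5 a" by blast
      then have "embedding n f (insert u (C \<union> X)) \<and> f u = u' \<and> (\<forall>c\<in>C. f c = g c)"
        using h5(2) h5'(2) by (intro conjI; (elim embedding_subset)?) auto
      then show ?thesis by blast
    qed
  qed
qed

end

context graded_pair
begin

text \<open>Induction climbing along the ancestors of \<open>a\<close>. Let \<open>w\<close> be the
  lowest proper ancestor that has a node of \<open>X\<close> at or below it. The nodes at or below
  \<open>w\<close> are placed by \<open>embed_down\<close>, the remaining ones by induction at
  \<open>w\<close>. Of the seven levels per node, two are for the jump from \<open>a\<close> to the
  child \<open>c\<close> of \<open>w\<close>, one for the step to \<open>w\<close>, and four for the
  additional node that \<open>embed_down\<close> may have to place.\<close>

lemma embed_outside:
  assumes "sim (n + 7 * k) a a'" "a \<in> T" "a' \<in> T'" "k \<le> n"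
    and "X \<subseteq> T" "card X \<le> k" "\<And>x. x \<in> X \<Longrightarrow> \<not> prefix a x"
  shows "\<exists>h. embedding n h (insert a X) \<and> h a = a'"
  using assms
proof (induction k arbitrary: a a' X)
  case 0
  then have "X = {}" using tree_finite[OF tree] finite_subset by fastforce
  then show ?case using embedding_star[of n a a' "{}"] 0 by simp
next
  case (Suc k)
  show ?case
  proof (cases "X = {}")
    case True
    have "sim n a a'" using sim_mono[OF Suc.prems(1)] by simp
    with True show ?thesis using embedding_star[of n a a' "{}"] Suc.prems(2,3) by simp
  next
    case False
    then obtain x where x: "x \<in> X" by blast
    let ?Q = "\<lambda>w. strict_prefix w a \<and> (\<exists>x\<in>X. prefix w x)"
    have "?Q []" using x Suc.prems(7)[OF x] by (auto simp: prefix_order.less_le)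
    then obtain w where w: "?Q w" and max: "\<And>y. ?Q y \<Longrightarrow> length y \<le> length w"
      using ex_longest[of ?Q "[]" a] prefix_order.less_imp_le by auto
    obtain c where c: "child w c" "prefix c a" using w child_between by blast
    have notc: "\<not> prefix c y" if "y \<in> X" for y
    proof
      assume "prefix c y"
      with that Suc.prems(7)[OF that] c(2) have "?Q c" by (auto simp: prefix_order.less_le)
      then show False
        using max[of c] strict_prefix_length[OF child_strict_prefix[OF c(1)]] by simp
    qed
    have T: "c \<in> T" "w \<in> T"
      using tree_prefix_closed[OF tree Suc.prems(2)] c(2) w prefix_order.less_imp_le by blast+
    have "sim (n + 7 * k + 5 + 2) a a'" using sim_mono[OF Suc.prems(1)] by simp
    then obtain c' where c': "c' \<in> T'" "sim (n + 7 * k + 5) c c'" "same_pos a c a' c'"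
      using jump_up[of "n + 7 * k + 5" a a' c] Suc.prems(2,3) c(2) by blast
    have "sim (Suc (n + 7 * k + 4)) c c'" using sim_mono[OF c'(2)] by simp
    then obtain w' where w': "w' \<in> T'" "child w' c'" "sim (n + 7 * k + 4) w w'"
      using sim_step[of "n + 7 * k + 4" c c' "child\<inverse>\<inverse>" w] c(1) T by (auto simp: rels_def)
    let ?Xw = "{x \<in> X. prefix w x}"
    have "card ?Xw \<le> card X"
      by (rule card_mono) (use Suc.prems(5) tree_finite[OF tree] finite_subset in auto)
    \<comment> \<open>The child \<open>c\<close> counts as a taken branch, so that no node of
      \<open>X\<close> is sent into the branch of \<open>w'\<close> leading to \<open>a'\<close>.
      This reserved branch is the reason for requiring \<open>k \<le> n\<close> and not just
      \<open>k \<le> Suc n\<close>.\<close>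
    have "\<exists>h. embedding n h (insert w ({c} \<union> ?Xw)) \<and> h w = w' \<and> (\<forall>d\<in>{c}. h d = c')"
    proof (rule embed_down[of n "Suc k"])
      show "sim (n + 4 * Suc k) w w'" using sim_mono[OF w'(3)] by simp
      show "d \<in> T \<and> child w d \<and> c' \<in> T' \<and> child w' c' \<and> sim (n + 4 * Suc k) d c'"
        if "d \<in> {c}" for d
        using that T c(1) c'(1) w'(2) sim_mono[OF c'(2), of "n + 4 * Suc k"] by simp
      show "card ?Xw \<le> Suc k" using \<open>card ?Xw \<le> card X\<close> Suc.prems(6) by simp
    qed (use T w' notc Suc.prems in auto)
    then obtain h1 where h1: "embedding n h1 (insert w ({c} \<union> ?Xw))" "h1 w = w'" "h1 c = c'"
      by blast
    have "\<exists>h. embedding n h (insert w (X - ?Xw)) \<and> h w = w'"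
    proof (rule Suc.IH)
      show "sim (n + 7 * k) w w'" using sim_mono[OF w'(3)] by simp
      have "card (X - ?Xw) < card X"
        by (rule psubset_card_mono) (use Suc.prems(5) tree_finite[OF tree] finite_subset w in auto)
      then show "card (X - ?Xw) \<le> k" using Suc.prems(6) by simp
    qed (use T w' Suc.prems in auto)
    then obtain h2 where h2: "embedding n h2 (insert w (X - ?Xw))" "h2 w = w'" by blast
    have "\<exists>f. embedding n f (insert w (X - ?Xw) \<union> insert w ({c} \<union> ?Xw)) \<and>
        (\<forall>a\<in>insert w (X - ?Xw). f a = h2 a) \<and> (\<forall>b\<in>insert w ({c} \<union> ?Xw). f b = h1 b)"
      by (intro embedding_glue[OF h2(1) h1(1), of w])
        (use h1 h2 child_strict_prefix[OF c(1)] in \<open>auto dest: prefix_order.less_imp_le\<close>)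
    then obtain h3 where h3: "embedding n h3 (insert w (X - ?Xw) \<union> insert w ({c} \<union> ?Xw))" "h3 c = c'"
      using h1(3) by auto
    have "sim n a a'" "sim n c c'" using sim_mono[OF Suc.prems(1)] sim_mono[OF c'(2)] by simp_all
    then obtain e where e: "embedding n e {a, c}" "e a = a'" "e c = c'"
      using embedding_edge Suc.prems(2,3) T(1) c' by blast
    \<comment> \<open>By the choice of \<open>w\<close> nothing placed so far is strictly below
      \<open>c\<close>, so \<open>a\<close> can be attached at \<open>c\<close>.\<close>
    have "\<exists>f. embedding n f ((insert w (X - ?Xw) \<union> insert w ({c} \<union> ?Xw)) \<union> {a, c}) \<and>
        (\<forall>b\<in>insert w (X - ?Xw) \<union> insert w ({c} \<union> ?Xw). f b = h3 b) \<and> (\<forall>b\<in>{a, c}. f b = e b)"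
      by (intro embedding_glue[OF h3(1) e(1), of c])
        (use h3(2) e child_not_below[OF c(1)] notc c(2) in \<open>auto dest: prefix_order.less_imp_le\<close>)
    then obtain f where "embedding n f ((insert w (X - ?Xw) \<union> insert w ({c} \<union> ?Xw)) \<union> {a, c})" "f a = a'"
      using e(2) by auto
    then have "embedding n f (insert a X) \<and> f a = a'"
      by (intro conjI; (elim embedding_subset)?) auto
    then show ?thesis by blast
  qed
qed

text \<open>The nodes at or below \<open>a\<close> and the others are embedded separately and glued
  at \<open>a\<close>.\<close>

lemma embed_any:
  assumes "sim (n + 7 * k) a a'" "a \<in> T" "a' \<in> T'" "k \<le> n" "X \<subseteq> T" "card X \<le> k"
  shows "\<exists>h. embedding n h (insert a X) \<and> h a = a'"
proof -
  let ?X = "{x \<in> X. prefix a x}"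
  have fin: "finite X" using assms(5) tree_finite[OF tree] finite_subset by blast
  then have card: "card ?X \<le> k" "card (X - ?X) \<le> k"
    using assms(6) card_mono[of X ?X] card_mono[of X "X - ?X"] by auto
  have "\<exists>h. embedding n h (insert a ({} \<union> ?X)) \<and> h a = a' \<and> (\<forall>d\<in>{}. h d = d)"
    by (rule embed_down[of n k]) (use assms card sim_mono[OF assms(1), of "n + 4 * k"] in auto)
  then obtain h1 where h1: "embedding n h1 (insert a ?X)" "h1 a = a'" by auto
  have "\<exists>h. embedding n h (insert a (X - ?X)) \<and> h a = a'"
    by (rule embed_outside[OF assms(1-4)]) (use assms(5) card in auto)
  then obtain h2 where h2: "embedding n h2 (insert a (X - ?X))" "h2 a = a'" by blast
  have "\<exists>f. embedding n f (insert a (X - ?X) \<union> insert a ?X) \<and>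
      (\<forall>b\<in>insert a (X - ?X). f b = h2 b) \<and> (\<forall>b\<in>insert a ?X. f b = h1 b)"
    by (intro embedding_glue[OF h2(1) h1(1), of a])
      (use h1 h2 in \<open>auto dest: prefix_order.less_imp_le\<close>)
  then obtain f where "embedding n f (insert a (X - ?X) \<union> insert a ?X)" "f a = a'"
    using h1(2) by auto
  then have "embedding n f (insert a X) \<and> f a = a'"
    by (intro conjI; (elim embedding_subset)?) auto
  then show ?thesis by blast
qed

end

section \<open>Mapping finitely many nodes homomorphically under ungraded types\<close>

context tree_pair
begin

text \<open>Only true atoms between nodes are kept: distinct nodes may be identified and
  incomparable ones become comparable. This freedom is what makes ungraded types sufficient.\<close>

definition homomorphism :: "nat \<Rightarrow> (nat list \<Rightarrow> nat list) \<Rightarrow> nat list set \<Rightarrow> bool" where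
  "homomorphism n h D \<longleftrightarrow> (\<forall>x\<in>D. x \<in> T \<and> h x \<in> T' \<and> sim n x (h x)) \<and>
     (\<forall>x\<in>D. \<forall>y\<in>D. (child x y \<longrightarrow> child (h x) (h y)) \<and>
        (strict_prefix x y \<longrightarrow> strict_prefix (h x) (h y)))"

lemma homomorphism_mono: "homomorphism n h D \<Longrightarrow> m \<le> n \<Longrightarrow> homomorphism m h D"
  using sim_mono unfolding homomorphism_def by blast

lemma homomorphism_subset: "homomorphism n h D \<Longrightarrow> E \<subseteq> D \<Longrightarrow> homomorphism n h E"
  unfolding homomorphism_def by blast

text \<open>The nearest placed ancestor \<open>u\<close> carries the whole constraint: other placed
  ancestors of \<open>x\<close> lie above \<open>u\<close>, so they are not its parent, and their
  images lie above the image of \<open>u\<close>. Nothing placed lies below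
  \<open>x\<close>.\<close>

lemma homomorphism_extend_down:
  assumes h: "homomorphism (Suc n) h D" and "x \<in> T" "x \<notin> D" "u \<in> D" "strict_prefix u x"
    and max: "\<And>d. d \<in> D \<Longrightarrow> strict_prefix d x \<Longrightarrow> prefix d u"
    and leaf: "\<And>d. d \<in> D \<Longrightarrow> \<not> strict_prefix x d"
  shows "\<exists>x'. homomorphism n (h(x := x')) (insert x D)"
proof -
  have "sim (Suc n) u (h u)" using h \<open>u \<in> D\<close> by (simp add: homomorphism_def)
  from sim_step_down[OF this assms(2,5)] obtain x' where x': "x' \<in> T'" "strict_prefix (h u) x'"
    "child u x \<longrightarrow> child (h u) x'" "sim n x x'" by blast
  have "strict_prefix (h d) x' \<and> (child d x \<longrightarrow> child (h d) x')"
    if d: "d \<in> D" "strict_prefix d x" for d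
  proof (cases "d = u")
    case False
    with max[OF d] have du: "strict_prefix d u" by (simp add: prefix_order.less_le)
    then have "\<not> child d x"
      using child_no_between[of d x u] assms(5) prefix_order.leD by blast
    moreover have "strict_prefix (h d) (h u)"
      using h d(1) \<open>u \<in> D\<close> du unfolding homomorphism_def by simp
    then have "strict_prefix (h d) x'" using x'(2) by (rule prefix_order.less_trans)
    ultimately show ?thesis by simp
  qed (use x' in simp)
  then have "homomorphism n (h(x := x')) (insert x D)"
    using homomorphism_mono[OF h, of n] x' \<open>x \<in> T\<close> \<open>x \<notin> D\<close> leaf
      child_strict_prefix[of _ x] child_strict_prefix[of x]
    unfolding homomorphism_def by auto
  then show ?thesis by blast
qed

text \<open>The dual situation: \<open>u\<close> is the topmost placed node, so a position above
  \<open>h u\<close> is above all images, and only \<open>u\<close> can be a child of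
  \<open>x\<close>.\<close>

lemma homomorphism_extend_up:
  assumes h: "homomorphism (Suc n) h D" and "x \<in> T" "x \<notin> D" "u \<in> D"
    and min: "\<And>d. d \<in> D \<Longrightarrow> prefix u d" and "strict_prefix x u"
  shows "\<exists>x'. homomorphism n (h(x := x')) (insert x D)"
proof -
  have "sim (Suc n) u (h u)" using h \<open>u \<in> D\<close> by (simp add: homomorphism_def)
  from sim_step_up[OF this assms(2,6)] obtain x' where x': "x' \<in> T'" "strict_prefix x' (h u)"
    "child x u \<longrightarrow> child x' (h u)" "sim n x x'" by blast
  have up: "strict_prefix x' (h d) \<and> (child x d \<longrightarrow> child x' (h d))" if d: "d \<in> D" for d
  proof (cases "d = u")
    case False
    with min[OF d] have ud: "strict_prefix u d" by (simp add: prefix_order.less_le)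
    then have "\<not> child x d"
      using child_no_between[of x d u] assms(6) prefix_order.leD by blast
    moreover have "strict_prefix (h u) (h d)"
      using h d(1) \<open>u \<in> D\<close> ud unfolding homomorphism_def by simp
    with x'(2) have "strict_prefix x' (h d)" by (rule prefix_order.less_trans)
    ultimately show ?thesis by simp
  qed (use x' in simp)
  have "\<not> strict_prefix d x" if "d \<in> D" for d
    using min[OF that] assms(6) prefix_order.leD prefix_order.less_trans by blast
  then have "homomorphism n (h(x := x')) (insert x D)"
    using homomorphism_mono[OF h, of n] x' \<open>x \<in> T\<close> \<open>x \<notin> D\<close> up
      child_strict_prefix[of _ x] child_strict_prefix[of x]
    unfolding homomorphism_def by auto
  then show ?thesis by blast
qed

lemma homomorphism_singleton:
  "sim n a a' \<Longrightarrow> a \<in> T \<Longrightarrow> a' \<in> T' \<Longrightarrow> homomorphism n (\<lambda>_. a') {a}"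
  using child_strict_prefix by (auto simp: homomorphism_def)

text \<open>The ancestors of \<open>a\<close> form a chain and are added from the bottom up, so each
  is reached by one upward step from the current top. The induction therefore removes the shortest
  node and adds it last.\<close>

lemma homomorphism_chain:
  assumes "sim (n + k) a a'" "a \<in> T" "a' \<in> T'" "finite X" "card X \<le> k"
    and "\<And>x. x \<in> X \<Longrightarrow> strict_prefix x a"
  shows "\<exists>h. homomorphism n h (insert a X) \<and> h a = a'"
  using assms(4,1,5,6)
proof (induction X arbitrary: n k rule: finite_psubset_induct)
  case (psubset X)
  show ?case
  proof (cases "X = {}")
    case True
    have "sim n a a'" using sim_mono[OF psubset.prems(1)] by simp
    with True show ?thesis using homomorphism_singleton assms(2,3) by blast
  next
    case False
    then obtain x where x: "x \<in> X" and min: "\<And>y. y \<in> X \<Longrightarrow> length x \<le> length y"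
      using ex_has_least_nat[of "\<lambda>x. x \<in> X" _ length] by blast
    let ?X = "X - {x}"
    have card: "card ?X = card X - 1" "card X \<noteq> 0" using x psubset.hyps by auto
    have "\<exists>h. homomorphism (Suc n) h (insert a ?X) \<and> h a = a'"
    proof (rule psubset.IH)
      show "sim (Suc n + (k - 1)) a a'"
        using card psubset.prems(1,2) by (cases k) simp_all
    qed (use x card psubset.prems in auto)
    then obtain h where h: "homomorphism (Suc n) h (insert a ?X)" "h a = a'" by blast
    obtain u where u: "u \<in> insert a ?X" and umin: "\<And>y. y \<in> insert a ?X \<Longrightarrow> length u \<le> length y"
      using ex_has_least_nat[of "\<lambda>x. x \<in> insert a ?X" a length] by blast
    have below: "prefix y a" if "y \<in> insert a X" for y
      using that psubset.prems(3) prefix_order.less_imp_le by auto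
    have comp: "prefix y z" if "y \<in> insert a X" "z \<in> insert a X" "length y \<le> length z" for y z
      using that below prefix_length_prefix by blast
    have xa: "x \<noteq> a" using psubset.prems(3)[OF x] by auto
    have xu: "strict_prefix x u"
    proof -
      have "prefix x u"
        using u below[of x] min x psubset.prems(3) comp[of x u] by auto
      moreover have "x \<noteq> u" using u xa by auto
      ultimately show ?thesis by (simp add: prefix_order.less_le)
    qed
    have "x \<in> T" using tree_prefix_closed[OF tree assms(2)] below x by blast
    obtain x' where "homomorphism n (h(x := x')) (insert x (insert a ?X))"
      using homomorphism_extend_up[OF h(1) \<open>x \<in> T\<close> _ u _ xu] xa comp u umin by auto
    moreover have "insert x (insert a ?X) = insert a X" using x by blast
    moreover have "(h(x := x')) a = a'" using h(2) xa by simp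
    ultimately show ?thesis by (intro exI[of _ "h(x := x')"]) (simp only:)
  qed
qed

text \<open>Nodes are added by increasing length, so nothing placed lies below the new one. The root
  in \<open>D\<close> guarantees a placed ancestor from which to step down.\<close>

lemma homomorphism_extend:
  assumes "finite X" "homomorphism (n + k) h D" "card X \<le> k" "X \<subseteq> T" "X \<inter> D = {}" "[] \<in> D" "finite D"
    and "\<And>x d. x \<in> X \<Longrightarrow> d \<in> D \<Longrightarrow> \<not> strict_prefix x d"
  shows "\<exists>h'. homomorphism n h' (D \<union> X) \<and> (\<forall>d\<in>D. h' d = h d)"
  using assms(1-5,8)
proof (induction X arbitrary: n k rule: finite_psubset_induct)
  case (psubset X)
  show ?case
  proof (cases "X = {}")
    case True
    then show ?thesis using homomorphism_mono[OF psubset.prems(1), of n] by auto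
  next
    case False
    then have "Max (length ` X) \<in> length ` X" using psubset.hyps by simp
    then obtain x where x: "x \<in> X" and "Max (length ` X) = length x" by auto
    then have max: "length y \<le> length x" if "y \<in> X" for y
      using Max_ge[of "length ` X" "length y"] that psubset.hyps by simp
    let ?X = "X - {x}"
    have card: "card ?X = card X - 1" "card X \<noteq> 0" using x psubset.hyps by auto
    have "\<exists>h'. homomorphism (Suc n) h' (D \<union> ?X) \<and> (\<forall>d\<in>D. h' d = h d)"
    proof (rule psubset.IH)
      show "homomorphism (Suc n + (k - 1)) h D"
        using card psubset.prems(1,2) by (cases k) simp_all
    qed (use x psubset.prems card in auto)
    then obtain g where g: "homomorphism (Suc n) g (D \<union> ?X)" "\<forall>d\<in>D. g d = h d" by blast
    let ?Q = "\<lambda>u. u \<in> D \<union> ?X \<and> strict_prefix u x"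
    have "x \<notin> D" using x psubset.prems(4) by blast
    then have "?Q []" using assms(6) by (auto simp: prefix_order.less_le)
    then obtain u where u: "?Q u" and umax: "\<And>y. ?Q y \<Longrightarrow> length y \<le> length u"
      using ex_longest[of ?Q "[]" x] prefix_order.less_imp_le by auto
    have "\<exists>x'. homomorphism n (g(x := x')) (insert x (D \<union> ?X))"
    proof (rule homomorphism_extend_down[OF g(1)])
      show "prefix d u" if "d \<in> D \<union> ?X" "strict_prefix d x" for d
        using umax[of d] that u prefix_length_prefix[of d x u] prefix_order.less_imp_le by blast
      show "\<not> strict_prefix x d" if "d \<in> D \<union> ?X" for d
        using that psubset.prems(5)[OF x] max[of d] strict_prefix_length[of x d] by auto
    qed (use u x psubset.prems \<open>x \<notin> D\<close> in auto)
    then obtain x' where "homomorphism n (g(x := x')) (insert x (D \<union> ?X))" by blast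
    moreover have "insert x (D \<union> ?X) = D \<union> X" using x by blast
    moreover have "\<forall>d\<in>D. (g(x := x')) d = h d" using g(2) \<open>x \<notin> D\<close> by auto
    ultimately show ?thesis by (intro exI[of _ "g(x := x')"]) (simp only:)
  qed
qed

text \<open>The ancestors of \<open>a\<close> together with the root cost up to \<open>k + 1\<close>
  levels, the remaining nodes up to \<open>k\<close>. Nodes incomparable with \<open>a\<close> are
  reached from their lowest placed ancestor, possibly the root.\<close>

lemma homomorphism_any:
  assumes "sim (n + 2 * k + 1) a a'" "a \<in> T" "a' \<in> T'" "X \<subseteq> T" "card X \<le> k"
  shows "\<exists>h. homomorphism n h (insert a X) \<and> h a = a'"
proof -
  have fin: "finite X" using assms(4) tree_finite[OF tree] finite_subset by blast
  let ?A = "{x \<in> insert [] X. strict_prefix x a}"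
  let ?B = "X - insert a ?A"
  have "card ?A \<le> card (insert [] X)" using fin by (intro card_mono) auto
  also have "\<dots> \<le> Suc k" using fin assms(5) by (simp add: card_insert_if)
  finally have A: "card ?A \<le> Suc k" .
  have B: "card ?B \<le> k" using fin assms(5) card_mono[of X ?B] by auto
  have "sim ((n + k) + Suc k) a a'" using sim_mono[OF assms(1)] by simp
  then have "\<exists>h. homomorphism (n + k) h (insert a ?A) \<and> h a = a'"
    by (rule homomorphism_chain) (use assms(2,3) fin A in auto)
  then obtain h where h: "homomorphism (n + k) h (insert a ?A)" "h a = a'" by blast
  have "\<exists>h'. homomorphism n h' (insert a ?A \<union> ?B) \<and> (\<forall>d\<in>insert a ?A. h' d = h d)"
  proof (rule homomorphism_extend[OF _ h(1) B])
    show "\<not> strict_prefix x d" if "x \<in> ?B" "d \<in> insert a ?A" for x d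
      using that prefix_order.less_trans by blast
  qed (use fin assms(4) in \<open>auto simp: prefix_order.less_le\<close>)
  then obtain f where f: "homomorphism n f (insert a ?A \<union> ?B)" "f a = a'" using h(2) by auto
  have "homomorphism n f (insert a X)"
    by (rule homomorphism_subset[OF f(1)]) auto
  with f show ?thesis by blast
qed

end

section \<open>Semantics of formulas\<close>

lemma sat_cong: "(\<And>x. x \<in> fv \<phi> \<Longrightarrow> s x = s' x) \<Longrightarrow> sat T V s \<phi> \<longleftrightarrow> sat T V s' \<phi>"
proof (induction \<phi> arbitrary: s s')
  case (Ex x \<phi>)
  have "sat T V (s(x := a)) \<phi> \<longleftrightarrow> sat T V (s'(x := a)) \<phi>" for a
    by (rule Ex.IH) (use Ex.prems in auto)
  then show ?case by (simp only: sat.simps)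
next
  case (All x \<phi>)
  have "sat T V (s(x := a)) \<phi> \<longleftrightarrow> sat T V (s'(x := a)) \<phi>" for a
    by (rule All.IH) (use All.prems in auto)
  then show ?case by (simp only: sat.simps)
next
  case (AtLeast C x \<phi>)
  have "sat T V (s(x := a)) \<phi> \<longleftrightarrow> sat T V (s'(x := a)) \<phi>" for a
    by (rule AtLeast.IH) (use AtLeast.prems in auto)
  then show ?case by (simp only: sat.simps)
next
  case (AtMost C x \<phi>)
  have "sat T V (s(x := a)) \<phi> \<longleftrightarrow> sat T V (s'(x := a)) \<phi>" for a
    by (rule AtMost.IH) (use AtMost.prems in auto)
  then show ?case by (simp only: sat.simps)
next
  case (Neg \<phi>)
  have "sat T V s \<phi> \<longleftrightarrow> sat T V s' \<phi>"
    by (rule Neg.IH) (use Neg.prems in auto)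
  then show ?case by simp
next
  case (Conj \<phi> \<psi>)
  have "sat T V s \<phi> \<longleftrightarrow> sat T V s' \<phi>"
    by (rule Conj.IH(1)) (use Conj.prems in auto)
  moreover have "sat T V s \<psi> \<longleftrightarrow> sat T V s' \<psi>"
    by (rule Conj.IH(2)) (use Conj.prems in auto)
  ultimately show ?case by simp
next
  case (Disj \<phi> \<psi>)
  have "sat T V s \<phi> \<longleftrightarrow> sat T V s' \<phi>"
    by (rule Disj.IH(1)) (use Disj.prems in auto)
  moreover have "sat T V s \<psi> \<longleftrightarrow> sat T V s' \<psi>"
    by (rule Disj.IH(2)) (use Disj.prems in auto)
  ultimately show ?case by simp
qed simp_all

lemma finite_fv: "finite (fv \<phi>)"
  by (induction \<phi>) auto

lemma fv_exs [simp]: "fv (exs xs \<phi>) = fv \<phi> - set xs"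
  by (induction xs) (auto simp: exs_def)

lemma preds_exs [simp]: "preds (exs xs \<phi>) = preds \<phi>"
  by (induction xs) (auto simp: exs_def)

lemma preds_alls [simp]: "preds (alls xs \<phi>) = preds \<phi>"
  by (induction xs) (auto simp: alls_def)

lemma fv_alls [simp]: "fv (alls xs \<phi>) = fv \<phi> - set xs"
  by (induction xs) (auto simp: alls_def)

lemma sat_exs:
  "sat T V s (exs xs \<phi>) \<longleftrightarrow>
     (\<exists>t. (\<forall>x\<in>set xs. t x \<in> T) \<and> (\<forall>x. x \<notin> set xs \<longrightarrow> t x = s x) \<and> sat T V t \<phi>)"
proof (induction xs arbitrary: s)
  case Nil
  have "t = s" if "\<And>x. t x = s x" for t :: "nat \<Rightarrow> nat list"
    using that by (rule ext)
  then show ?case unfolding exs_def by auto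
next
  case (Cons x xs)
  have "sat T V s (exs (x # xs) \<phi>) \<longleftrightarrow> (\<exists>a\<in>T. sat T V (s(x := a)) (exs xs \<phi>))"
    by (simp add: exs_def)
  also have "\<dots> \<longleftrightarrow> (\<exists>a\<in>T. \<exists>t. (\<forall>y\<in>set xs. t y \<in> T) \<and>
      (\<forall>y. y \<notin> set xs \<longrightarrow> t y = (s(x := a)) y) \<and> sat T V t \<phi>)"
    using Cons.IH by simp
  also have "\<dots> \<longleftrightarrow> (\<exists>t. (\<forall>y\<in>set (x # xs). t y \<in> T) \<and>
      (\<forall>y. y \<notin> set (x # xs) \<longrightarrow> t y = s y) \<and> sat T V t \<phi>)" (is "?L \<longleftrightarrow> ?R")
  proof
    assume ?L
    then obtain a t where "a \<in> T" and t: "\<forall>y\<in>set xs. t y \<in> T"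
      "\<forall>y. y \<notin> set xs \<longrightarrow> t y = (s(x := a)) y" "sat T V t \<phi>" by blast
    have "t x \<in> T" using t(1,2) \<open>a \<in> T\<close> by (cases "x \<in> set xs") simp_all
    then show ?R using t by (intro exI[of _ t]) auto
  next
    assume ?R
    then obtain t where t: "\<forall>y\<in>set (x # xs). t y \<in> T"
      "\<forall>y. y \<notin> set (x # xs) \<longrightarrow> t y = s y" "sat T V t \<phi>" by blast
    then show ?L by (intro bexI[of _ "t x"] exI[of _ t]) auto
  qed
  finally show ?case .
qed

lemma sat_alls: "sat T V s (alls xs \<phi>) \<longleftrightarrow> \<not> sat T V s (exs xs (Neg \<phi>))"
  by (induction xs arbitrary: s) (auto simp: alls_def exs_def)

section \<open>Invariance\<close>

text \<open>Types have to agree at all variables, not only at the free ones: even for a sentence the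
  two trees must be linked by some pair of points. Positions are compared between free variables
  only.\<close>

definition invariant :: "'p set \<Rightarrow> (nat \<Rightarrow> nat) \<Rightarrow> nat \<Rightarrow> 'p fo \<Rightarrow> bool" where
  "invariant P G n \<phi> \<longleftrightarrow> (\<forall>T V T' V' s s'.
     finite_tree T V \<longrightarrow> finite_tree T' V' \<longrightarrow>
     (\<forall>x. s x \<in> T \<and> s' x \<in> T' \<and> agree (probes P G n) (T, V, s x) (T', V', s' x)) \<longrightarrow>
     (\<forall>x\<in>fv \<phi>. \<forall>y\<in>fv \<phi>. same_pos (s x) (s y) (s' x) (s' y)) \<longrightarrow>
     (sat T V s \<phi> \<longleftrightarrow> sat T' V' s' \<phi>))"

lemma agree_probes_mono: "agree (probes P G n) q r \<Longrightarrow> m \<le> n \<Longrightarrow> agree (probes P G m) q r"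
  using probes_mono[of m n P G] by (auto simp: agree_def)

lemma invariantD:
  assumes "invariant P G n \<phi>" "finite_tree T V" "finite_tree T' V'"
    and "\<And>x. s x \<in> T \<and> s' x \<in> T' \<and> agree (probes P G n) (T, V, s x) (T', V', s' x)"
    and "\<And>x y. x \<in> fv \<phi> \<Longrightarrow> y \<in> fv \<phi> \<Longrightarrow> same_pos (s x) (s y) (s' x) (s' y)"
  shows "sat T V s \<phi> \<longleftrightarrow> sat T' V' s' \<phi>"
  using assms unfolding invariant_def by simp

lemma same_pos_flip: "same_pos x y x' y' \<Longrightarrow> same_pos x' y' x y"
  by (auto simp: same_pos_def)

lemma invariantI:
  assumes "\<And>T V T' V' s s'. finite_tree T V \<Longrightarrow> finite_tree T' V' \<Longrightarrow>
     (\<And>x. s x \<in> T \<and> s' x \<in> T' \<and> agree (probes P G n) (T, V, s x) (T', V', s' x)) \<Longrightarrow>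
     (\<And>x y. x \<in> fv \<phi> \<Longrightarrow> y \<in> fv \<phi> \<Longrightarrow> same_pos (s x) (s y) (s' x) (s' y)) \<Longrightarrow>
     sat T V s \<phi> \<Longrightarrow> sat T' V' s' \<phi>"
  shows "invariant P G n \<phi>"
  unfolding invariant_def
proof (intro allI impI iffI)
  fix T V T' V' s s'
  assume *: "finite_tree T V" "finite_tree T' V'"
    "\<forall>x. s x \<in> T \<and> s' x \<in> T' \<and> agree (probes P G n) (T, V, s x) (T', V', s' x)"
    "\<forall>x\<in>fv \<phi>. \<forall>y\<in>fv \<phi>. same_pos (s x) (s y) (s' x) (s' y)"
  show "sat T' V' s' \<phi>" if "sat T V s \<phi>"
    by (rule assms[OF *(1,2) _ _ that]) (use *(3,4) in auto)
  show "sat T V s \<phi>" if "sat T' V' s' \<phi>"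
  proof (rule assms[OF *(2,1) _ _ that])
    show "s' x \<in> T' \<and> s x \<in> T \<and> agree (probes P G n) (T', V', s' x) (T, V, s x)" for x
      using *(3) agree_sym[of "probes P G n" "(T, V, s x)"] by simp
    show "same_pos (s' x) (s' y) (s x) (s y)" if "x \<in> fv \<phi>" "y \<in> fv \<phi>" for x y
      by (rule same_pos_flip) (use *(4) that in simp)
  qed
qed

lemma invariant_mono:
  assumes "invariant P G m \<phi>" "m \<le> n"
  shows "invariant P G n \<phi>"
proof (rule invariantI)
  fix T V T' V' and s s' :: "nat \<Rightarrow> nat list"
  assume tree: "finite_tree T V" "finite_tree T' V'"
    and s: "\<And>x. s x \<in> T \<and> s' x \<in> T' \<and> agree (probes P G n) (T, V, s x) (T', V', s' x)"
    and pos: "\<And>x y. x \<in> fv \<phi> \<Longrightarrow> y \<in> fv \<phi> \<Longrightarrow> same_pos (s x) (s y) (s' x) (s' y)"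
    and sat: "sat T V s \<phi>"
  have "s x \<in> T \<and> s' x \<in> T' \<and> agree (probes P G m) (T, V, s x) (T', V', s' x)" for x
    using s[of x] agree_probes_mono[OF _ assms(2), of P G "(T, V, s x)"] by simp
  from iffD1[OF invariantD[OF assms(1) tree this pos] sat] show "sat T' V' s' \<phi>" .
qed

lemma invariant_atomic:
  assumes "atomic \<phi>" "preds \<phi> \<subseteq> P"
  shows "invariant P G 0 \<phi>"
proof (rule invariantI)
  fix T V T' V' and s s' :: "nat \<Rightarrow> nat list"
  assume s: "\<And>x. s x \<in> T \<and> s' x \<in> T' \<and> agree (probes P G 0) (T, V, s x) (T', V', s' x)"
    and pos: "\<And>x y. x \<in> fv \<phi> \<Longrightarrow> y \<in> fv \<phi> \<Longrightarrow> same_pos (s x) (s y) (s' x) (s' y)"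
    and "sat T V s \<phi>"
  show "sat T' V' s' \<phi>"
  proof (cases \<phi>)
    case (Pred p x)
    then have "p \<in> P" using assms(2) by simp
    then have "s x \<in> V p \<longleftrightarrow> s' x \<in> V' p" using s[of x] by (simp add: agree_def)
    then show ?thesis using Pred \<open>sat T V s \<phi>\<close> by simp
  qed (use assms(1) pos \<open>sat T V s \<phi>\<close> in \<open>auto simp: same_pos_def descendant_eq\<close>)
qed

lemma invariant_Neg: "invariant P G n \<phi> \<Longrightarrow> invariant P G n (Neg \<phi>)"
  unfolding invariant_def by simp

lemma invariant_Conj:
  assumes "invariant P G m \<phi>" "invariant P G n \<psi>"
  shows "invariant P G (max m n) (Conj \<phi> \<psi>)"
proof (rule invariantI)
  have inv: "invariant P G (max m n) \<phi>" "invariant P G (max m n) \<psi>"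
    by (rule invariant_mono[OF assms(1)] invariant_mono[OF assms(2)]; simp)+
  fix T V T' V' and s s' :: "nat \<Rightarrow> nat list"
  assume tree: "finite_tree T V" "finite_tree T' V'"
    and s: "\<And>x. s x \<in> T \<and> s' x \<in> T' \<and>
      agree (probes P G (max m n)) (T, V, s x) (T', V', s' x)"
    and pos: "\<And>x y. x \<in> fv (Conj \<phi> \<psi>) \<Longrightarrow> y \<in> fv (Conj \<phi> \<psi>) \<Longrightarrow>
      same_pos (s x) (s y) (s' x) (s' y)"
    and "sat T V s (Conj \<phi> \<psi>)"
  moreover have "sat T V s \<phi> \<longleftrightarrow> sat T' V' s' \<phi>"
    by (rule invariantD[OF inv(1) tree s pos]) simp_all
  moreover have "sat T V s \<psi> \<longleftrightarrow> sat T' V' s' \<psi>"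
    by (rule invariantD[OF inv(2) tree s pos]) simp_all
  ultimately show "sat T' V' s' (Conj \<phi> \<psi>)" by simp
qed

lemma invariant_Disj:
  assumes "invariant P G m \<phi>" "invariant P G n \<psi>"
  shows "invariant P G (max m n) (Disj \<phi> \<psi>)"
  using invariant_Neg[OF invariant_Conj[OF invariant_Neg[OF assms(1)] invariant_Neg[OF assms(2)]]]
  unfolding invariant_def by simp

text \<open>At most \<open>x\<close> remains free, so the embedding of the witnesses has to respect
  a single given pair, \<open>s x\<close> and \<open>s' x\<close>. With
  \<open>k = length ys\<close>, \<open>embed_any\<close> asks for level \<open>m + 7 * k\<close>
  where \<open>k \<le> m\<close>; the choice is \<open>m = n + k\<close>.\<close>

lemma invariant_one_dimensional:
  assumes "invariant P Suc n \<phi>" "fv \<phi> \<subseteq> insert x (set ys)"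
  shows "invariant P Suc (n + length ys + 7 * length ys) (exs ys \<phi>)"
proof (rule invariantI)
  fix T V T' V' and s s' :: "nat \<Rightarrow> nat list"
  let ?k = "length ys"
  assume trees: "finite_tree T V" "finite_tree T' V'"
    and s: "\<And>x. s x \<in> T \<and> s' x \<in> T' \<and>
      agree (probes P Suc (n + ?k + 7 * ?k)) (T, V, s x) (T', V', s' x)"
    and "sat T V s (exs ys \<phi>)"
  then obtain t where t: "\<And>y. y \<in> set ys \<Longrightarrow> t y \<in> T" "\<And>y. y \<notin> set ys \<Longrightarrow> t y = s y" "sat T V t \<phi>"
    unfolding sat_exs by blast
  interpret graded_pair P T V T' V'
    by unfold_locales (use trees in auto)
  have "\<exists>h. embedding (n + ?k) h (insert (s x) (t ` set ys)) \<and> h (s x) = s' x"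
  proof (rule embed_any)
    show "sim (n + ?k + 7 * ?k) (s x) (s' x)" using s by (simp add: sim_def)
    show "card (t ` set ys) \<le> ?k" by (meson List.finite_set card_image_le card_length order_trans)
  qed (use s t in auto)
  then obtain h where h: "embedding n h (insert (s x) (t ` set ys))" "h (s x) = s' x"
    using embedding_mono by (metis le_add1)
  define t' where "t' y = (if y \<in> set ys then h (t y) else s' y)" for y
  have ht: "t y \<in> insert (s x) (t ` set ys) \<and> t' y = h (t y)" if "y \<in> fv \<phi>" for y
    using that assms(2) h(2) t(2) by (cases "y \<in> set ys") (auto simp: t'_def)
  have "sat T' V' t' \<phi>"
  proof (rule iffD1[OF invariantD[OF assms(1) trees]])
    show "t y \<in> T \<and> t' y \<in> T' \<and> agree (probes P Suc n) (T, V, t y) (T', V', t' y)" for y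
    proof (cases "y \<in> set ys")
      case True
      then show ?thesis using h(1) t(1) by (simp add: embedding_def sim_def t'_def)
    next
      case False
      then show ?thesis
        using s[of y] t(2) agree_probes_mono[of P Suc "n + ?k + 7 * ?k" _ _ n] by (simp add: t'_def)
    qed
    show "same_pos (t y) (t z) (t' y) (t' z)" if "y \<in> fv \<phi>" "z \<in> fv \<phi>" for y z
      using h(1) ht[OF that(1)] ht[OF that(2)] unfolding embedding_def by metis
    show "sat T V t \<phi>" by fact
  qed
  moreover have "t' y \<in> T'" if "y \<in> set ys" for y
    using h(1) that by (simp add: embedding_def t'_def)
  ultimately show "sat T' V' s' (exs ys \<phi>)"
    unfolding sat_exs by (intro exI[of _ t']) (simp add: t'_def)
qed

lemma F1_invariant: "\<phi> \<in> F1_fmls \<Longrightarrow> preds \<phi> \<subseteq> P \<Longrightarrow> \<exists>n. invariant P Suc n \<phi>"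
proof (induction rule: F1_fmls.induct)
  case (atom \<phi>)
  then show ?case using invariant_atomic by blast
next
  case (neg \<phi>)
  then show ?case using invariant_Neg by fastforce
next
  case (disj \<phi> \<psi>)
  then show ?case using invariant_Disj by fastforce
next
  case (ex_all \<phi> x xs)
  then obtain n where "invariant P Suc n \<phi>" by auto
  from invariant_one_dimensional[OF this, of x "x # xs"] ex_all show ?case by blast
next
  case (ex_all_but_one \<phi> x xs)
  then obtain n where "invariant P Suc n \<phi>" by auto
  from invariant_one_dimensional[OF this, of x xs] ex_all_but_one show ?case by auto
qed

text \<open>A guard involves at most two variables, and when true it relates comparable nodes;
  \<open>u = v\<close> covers one-variable atoms. This is why vertical jumps suffice for guarded
  quantification.\<close>

lemma atomic_comparable:
  assumes "atomic \<alpha>" "sat T V t \<alpha>"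
  shows "\<exists>u v. fv \<alpha> = {u, v} \<and> prefix (t u) (t v)"
proof (cases \<alpha>)
  case (Pred p x)
  then show ?thesis by (intro exI[of _ x]) simp
next
  case (Child x y)
  then show ?thesis
    using assms(2) prefix_order.less_imp_le[OF child_strict_prefix, of "t x" "t y"]
    by - (rule exI[of _ x], rule exI[of _ y], simp)
next
  case (Desc x y)
  then show ?thesis
    using assms(2) prefix_order.less_imp_le[of "t x" "t y"]
    by - (rule exI[of _ x], rule exI[of _ y], simp add: descendant_eq)
next
  case (Equal x y)
  then show ?thesis using assms(2) by - (rule exI[of _ x], rule exI[of _ y], simp)
qed (use assms(1) in auto)

text \<open>If both guard variables are quantified, the upper node is found by
  \<open>jump_any\<close> and the lower one from it by \<open>jump_down\<close>, at two levels each;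
  hence the 4. If one of them is kept, the other is reached from it by a vertical jump.\<close>

lemma invariant_guarded:
  fixes \<psi> :: "'p fo"
  assumes "invariant P G n (Conj \<alpha> \<psi>)" "atomic \<alpha>" "fv \<psi> \<subseteq> fv \<alpha>" and G: "\<And>n. 1 \<le> G n"
  shows "invariant P G (n + 4) (exs vs (Conj \<alpha> \<psi>))"
proof (rule invariantI)
  fix T and V :: "'p \<Rightarrow> nat list set" and T' and V' :: "'p \<Rightarrow> nat list set"
    and s s' :: "nat \<Rightarrow> nat list"
  assume trees: "finite_tree T V" "finite_tree T' V'"
    and s: "\<And>x. s x \<in> T \<and> s' x \<in> T' \<and> agree (probes P G (n + 4)) (T, V, s x) (T', V', s' x)"
    and pos: "\<And>x y. x \<in> fv (exs vs (Conj \<alpha> \<psi>)) \<Longrightarrow> y \<in> fv (exs vs (Conj \<alpha> \<psi>)) \<Longrightarrow>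
      same_pos (s x) (s y) (s' x) (s' y)"
    and "sat T V s (exs vs (Conj \<alpha> \<psi>))"
  then obtain t where t: "\<And>y. y \<in> set vs \<Longrightarrow> t y \<in> T" "\<And>y. y \<notin> set vs \<Longrightarrow> t y = s y"
    "sat T V t (Conj \<alpha> \<psi>)"
    unfolding sat_exs by blast
  have tT: "t y \<in> T" for y using t s by (cases "y \<in> set vs") auto
  interpret tree_pair P G T V T' V'
    by unfold_locales (use trees G in auto)
  have sim: "sim m (s y) (s' y)" if "m \<le> n + 4" for m y
    unfolding sim_def using s by (intro agree_probes_mono[OF _ that]) simp
  obtain u v where uv: "fv \<alpha> = {u, v}" "prefix (t u) (t v)"
    using atomic_comparable[OF assms(2), of T V t] t(3) by auto
  have "\<exists>a\<in>T'. \<exists>b\<in>T'. sim n (t u) a \<and> sim n (t v) b \<and> same_pos (t u) (t v) a b \<and>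
      (u \<notin> set vs \<longrightarrow> a = s' u) \<and> (v \<notin> set vs \<longrightarrow> b = s' v)"
  proof (cases "u \<in> set vs"; cases "v \<in> set vs")
    assume uv': "u \<in> set vs" "v \<in> set vs"
    have "sim (n + 2 + 2) (s u) (s' u)" using sim by simp
    then obtain a where a: "a \<in> T'" "sim (n + 2) (t u) a"
      using jump_any s tT by blast
    then obtain b where "b \<in> T'" "sim n (t v) b" "same_pos (t u) (t v) a b"
      using jump_down uv(2) tT by blast
    with a uv' sim_mono[OF a(2), of n] show ?thesis by auto
  next
    assume uv': "u \<in> set vs" "v \<notin> set vs"
    then have "sim (n + 2) (t v) (s' v)" using sim t(2) by simp
    then obtain a where "a \<in> T'" "sim n (t u) a" "same_pos (t v) (t u) (s' v) a"
      using jump_up uv(2) tT s by blast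
    with uv' sim[of n v] t(2) s same_pos_commute show ?thesis by auto
  next
    assume uv': "u \<notin> set vs" "v \<in> set vs"
    then have "sim (n + 2) (t u) (s' u)" using sim t(2) by simp
    then obtain b where "b \<in> T'" "sim n (t v) b" "same_pos (t u) (t v) (s' u) b"
      using jump_down uv(2) tT s by blast
    with uv' sim[of n u] t(2) s show ?thesis by auto
  next
    assume uv': "u \<notin> set vs" "v \<notin> set vs"
    then show ?thesis using sim[of n] t(2) s pos[of u v] uv(1) by auto
  qed
  then obtain a b where ab: "a \<in> T'" "b \<in> T'" "sim n (t u) a" "sim n (t v) b"
    "same_pos (t u) (t v) a b" "u \<notin> set vs \<Longrightarrow> a = s' u" "v \<notin> set vs \<Longrightarrow> b = s' v" by blast
  \<comment> \<open>Quantified variables outside the guard still need values of matching type, since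
    \<open>invariant\<close> asks for agreement at every variable.\<close>
  have "\<exists>c\<in>T'. sim n (t z) c" for z
    using jump_any[of n "s z" "s' z" "t z"] sim s tT by simp
  then obtain f where f: "\<And>z. f z \<in> T' \<and> sim n (t z) (f z)" by metis
  define t' where
    "t' z = (if z \<notin> set vs then s' z else if z = u then a else if z = v then b else f z)" for z
  have t'_uv: "t' u = a" "t' v = b"
    using ab by (auto simp: t'_def same_pos_def)
  have "sat T' V' t' (Conj \<alpha> \<psi>)"
  proof (rule iffD1[OF invariantD[OF assms(1) trees]])
    show "t z \<in> T \<and> t' z \<in> T' \<and> agree (probes P G n) (T, V, t z) (T', V', t' z)" for z
      unfolding sim_def[symmetric] using tT ab f t(2) sim[of n z] s by (auto simp: t'_def)
    have "same_pos (t y) (t z) (t' y) (t' z)" if "y \<in> {u, v}" "z \<in> {u, v}" for y z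
      using that ab(5) same_pos_commute[OF ab(5)] same_pos_refl t'_uv by auto
    moreover have fv: "fv (Conj \<alpha> \<psi>) = {u, v}" using assms(3) uv(1) by auto
    ultimately show "same_pos (t y) (t z) (t' y) (t' z)" if "y \<in> fv (Conj \<alpha> \<psi>)" "z \<in> fv (Conj \<alpha> \<psi>)" for y z
      using that fv by blast
    show "sat T V t (Conj \<alpha> \<psi>)" by fact
  qed
  moreover have "t' y \<in> T'" for y
    using ab f s by (auto simp: t'_def)
  moreover have "t' y = s' y" if "y \<notin> set vs" for y
    using that by (simp add: t'_def)
  ultimately show "sat T' V' s' (exs vs (Conj \<alpha> \<psi>))"
    unfolding sat_exs by blast
qed

lemma invariant_guarded_ex:
  assumes "invariant P G n \<psi>" "preds \<alpha> \<subseteq> P" "atomic \<alpha>" "fv \<psi> \<subseteq> fv \<alpha>" "\<And>n. 1 \<le> G n"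
  shows "\<exists>m. invariant P G m (exs vs (Conj \<alpha> \<psi>))"
  using invariant_guarded[OF invariant_Conj[OF invariant_atomic[OF assms(3,2)] assms(1)] assms(3,4,5)]
  by blast

lemma GF_invariant:
  assumes G: "\<And>n. 1 \<le> G n"
  shows "\<phi> \<in> GF_fmls \<Longrightarrow> preds \<phi> \<subseteq> P \<Longrightarrow> \<exists>n. invariant P G n \<phi>"
proof (induction rule: GF_fmls.induct)
  case (atom \<phi>)
  then show ?case using invariant_atomic by blast
next
  case (neg \<phi>)
  then show ?case using invariant_Neg by fastforce
next
  case (disj \<phi> \<psi>)
  then show ?case using invariant_Disj by fastforce
next
  case (conj \<phi> \<psi>)
  then show ?case using invariant_Conj by fastforce
next
  case (ex \<psi> \<alpha> vs)
  then obtain n where "invariant P G n \<psi>" by auto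
  from invariant_guarded_ex[OF this, of \<alpha> vs] show ?case using ex G by auto
next
  case (all \<psi> \<alpha> vs)
  then obtain n where "invariant P G n \<psi>" by auto
  then have "invariant P G n (Neg \<psi>)" by (rule invariant_Neg)
  from invariant_guarded_ex[OF this, of \<alpha> vs] obtain m where "invariant P G m (exs vs (Conj \<alpha> (Neg \<psi>)))"
    using all G by auto
  then have "invariant P G m (Neg (exs vs (Conj \<alpha> (Neg \<psi>))))" by (rule invariant_Neg)
  moreover have "sat T V s (alls vs (Imp \<alpha> \<psi>)) \<longleftrightarrow> sat T V s (Neg (exs vs (Conj \<alpha> (Neg \<psi>))))" for T V s
    by (simp add: sat_alls sat_exs)
  moreover have "fv (alls vs (Imp \<alpha> \<psi>)) = fv (Neg (exs vs (Conj \<alpha> (Neg \<psi>))))"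
    by simp
  ultimately have "invariant P G m (alls vs (Imp \<alpha> \<psi>))"
    unfolding invariant_def by (simp only:)
  then show ?case by blast
qed

section \<open>Unary negation: bounded witness sets carried along homomorphisms\<close>

definition transports ::
  "'p set \<Rightarrow> nat \<Rightarrow> 'p fo \<Rightarrow> nat list set \<Rightarrow> ('p \<Rightarrow> nat list set) \<Rightarrow> (nat \<Rightarrow> nat list) \<Rightarrow> nat list set \<Rightarrow> bool"
  where "transports P n \<phi> T V s D \<longleftrightarrow> (\<forall>T' V' h. finite_tree T' V' \<longrightarrow>
    tree_pair.homomorphism P (\<lambda>_. 1) T V T' V' n h D \<longrightarrow> sat T' V' (h \<circ> s) \<phi>)"

lemma transportsI:
  assumes "\<And>T' V' h. finite_tree T' V' \<Longrightarrow> tree_pair.homomorphism P (\<lambda>_. 1) T V T' V' n h D \<Longrightarrow>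
    sat T' V' (h \<circ> s) \<phi>"
  shows "transports P n \<phi> T V s D"
  unfolding transports_def by (intro allI impI assms)

lemma transportsD:
  assumes "transports P n \<phi> T V s D" "finite_tree T' V'"
    "tree_pair.homomorphism P (\<lambda>_. 1) T V T' V' n h D"
  shows "sat T' V' (h \<circ> s) \<phi>"
  using assms(1)[unfolded transports_def, rule_format, OF assms(2,3)] .

text \<open>The induction hypothesis for \<open>UNFO\<close>. \<open>D\<close> collects the values
  of the free variables and the witnesses of existential quantifiers outside negations;
  \<open>n\<close> and \<open>k\<close> do not depend on the tree.\<close>

definition witnessed :: "'p set \<Rightarrow> nat \<Rightarrow> nat \<Rightarrow> 'p fo \<Rightarrow> bool" where
  "witnessed P n k \<phi> \<longleftrightarrow> (\<forall>T V s. finite_tree T V \<longrightarrow> range s \<subseteq> T \<longrightarrow> sat T V s \<phi> \<longrightarrow>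
     (\<exists>D\<subseteq>T. card D \<le> k \<and> s ` fv \<phi> \<subseteq> D \<and> transports P n \<phi> T V s D))"

lemma witnessedD:
  assumes "witnessed P n k \<phi>" "finite_tree T V" "range s \<subseteq> T" "sat T V s \<phi>"
  shows "\<exists>D\<subseteq>T. card D \<le> k \<and> s ` fv \<phi> \<subseteq> D \<and> transports P n \<phi> T V s D"
  using assms(1)[unfolded witnessed_def, rule_format, OF assms(2-4)] .

lemma witnessedI:
  assumes "\<And>T V s. finite_tree T V \<Longrightarrow> range s \<subseteq> T \<Longrightarrow> sat T V s \<phi> \<Longrightarrow>
     \<exists>D\<subseteq>T. card D \<le> k \<and> s ` fv \<phi> \<subseteq> D \<and> transports P n \<phi> T V s D"
  shows "witnessed P n k \<phi>"
  unfolding witnessed_def by (intro allI impI assms)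

lemma tree_pairI: "finite_tree T V \<Longrightarrow> finite_tree T' V' \<Longrightarrow> tree_pair (\<lambda>_. 1) T V T' V'"
  by unfold_locales auto

lemma transports_mono:
  assumes "transports P n \<phi> T V s D" "finite_tree T V" "n \<le> n'" "D \<subseteq> E"
  shows "transports P n' \<phi> T V s E"
proof (rule transportsI)
  fix T' V' h
  assume T': "finite_tree T' V'" and h: "tree_pair.homomorphism P (\<lambda>_. 1) T V T' V' n' h E"
  interpret tree_pair P "\<lambda>_. 1" T V T' V' by (rule tree_pairI[OF assms(2) T'])
  show "sat T' V' (h \<circ> s) \<phi>"
    by (rule transportsD[OF assms(1) T' homomorphism_subset[OF homomorphism_mono[OF h assms(3)] assms(4)]])
qed

lemma witnessed_mono:
  assumes "witnessed P n k \<phi>" "n \<le> n'" "k \<le> k'"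
  shows "witnessed P n' k' \<phi>"
proof (rule witnessedI)
  fix T V s assume A: "finite_tree T V" "range s \<subseteq> T" "sat T V s \<phi>"
  obtain D where D: "D \<subseteq> T" "card D \<le> k" "s ` fv \<phi> \<subseteq> D" "transports P n \<phi> T V s D"
    using witnessedD[OF assms(1) A] by blast
  from transports_mono[OF D(4) A(1) assms(2) order_refl] D(1-3) assms(3)
  show "\<exists>D\<subseteq>T. card D \<le> k' \<and> s ` fv \<phi> \<subseteq> D \<and> transports P n' \<phi> T V s D"
    by (intro exI[of _ D] conjI) simp_all
qed

lemma witnessed_atomic:
  assumes "atomic \<phi>" "preds \<phi> \<subseteq> P"
  shows "witnessed P 0 2 \<phi>"
proof (rule witnessedI)
  fix T V s assume A: "finite_tree T V" "range s \<subseteq> T" "sat T V s \<phi>"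
  have "card (fv \<phi>) \<le> 2"
    using assms(1) by (cases \<phi>) (auto simp: card_insert_if)
  then have "card (s ` fv \<phi>) \<le> 2"
    using card_image_le[OF finite_fv, of s \<phi>] by simp
  moreover have "transports P 0 \<phi> T V s (s ` fv \<phi>)"
  proof (rule transportsI)
    fix T' V' h
    assume T': "finite_tree T' V'"
      and h: "tree_pair.homomorphism P (\<lambda>_. 1) T V T' V' 0 h (s ` fv \<phi>)"
    interpret tree_pair P "\<lambda>_. 1" T V T' V' by (rule tree_pairI[OF A(1) T'])
    show "sat T' V' (h \<circ> s) \<phi>"
    proof (cases \<phi>)
      case (Pred p x)
      then show ?thesis
        using A(3) h assms(2) sim_prop[of 0 "s x" "h (s x)" p] unfolding homomorphism_def by auto
    qed (use A(3) h[unfolded homomorphism_def] assms(1) in \<open>auto simp: descendant_eq\<close>)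
  qed
  moreover have "s ` fv \<phi> \<subseteq> T" using A(2) by auto
  ultimately show "\<exists>D\<subseteq>T. card D \<le> 2 \<and> s ` fv \<phi> \<subseteq> D \<and> transports P 0 \<phi> T V s D"
    by blast
qed

lemma witnessed_Disj:
  assumes "witnessed P n k \<phi>" "witnessed P n k \<psi>"
  shows "witnessed P n (k + card (fv \<phi>) + card (fv \<psi>)) (Disj \<phi> \<psi>)"
proof (rule witnessedI)
  fix T V s assume A: "finite_tree T V" "range s \<subseteq> T" "sat T V s (Disj \<phi> \<psi>)"
  have "\<exists>D\<subseteq>T. card D \<le> k \<and> transports P n (Disj \<phi> \<psi>) T V s D"
  proof (cases "sat T V s \<phi>")
    case True
    from witnessedD[OF assms(1) A(1,2) True] show ?thesis
      unfolding transports_def sat.simps by meson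
  next
    case False
    with A(3) have "sat T V s \<psi>" by simp
    from witnessedD[OF assms(2) A(1,2) this] show ?thesis
      unfolding transports_def sat.simps by meson
  qed
  then obtain D where D: "D \<subseteq> T" "card D \<le> k" "transports P n (Disj \<phi> \<psi>) T V s D"
    by blast
  \<comment> \<open>Only the true disjunct is transported, but the free variables of both must have
    their values in the witness set.\<close>
  let ?D = "D \<union> s ` fv \<phi> \<union> s ` fv \<psi>"
  have "card ?D \<le> card D + card (s ` fv \<phi>) + card (s ` fv \<psi>)"
    using card_Un_le[of "D \<union> s ` fv \<phi>" "s ` fv \<psi>"] card_Un_le[of D "s ` fv \<phi>"] by linarith
  then have "card ?D \<le> k + card (fv \<phi>) + card (fv \<psi>)"
    using D(2) card_image_le[OF finite_fv, of s \<phi>] card_image_le[OF finite_fv, of s \<psi>] by linarith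
  moreover have "transports P n (Disj \<phi> \<psi>) T V s ?D"
    by (rule transports_mono[OF D(3) A(1)]) auto
  moreover have "?D \<subseteq> T" "s ` fv (Disj \<phi> \<psi>) \<subseteq> ?D" using D(1) A(2) by auto
  ultimately show "\<exists>D\<subseteq>T. card D \<le> k + card (fv \<phi>) + card (fv \<psi>) \<and> s ` fv (Disj \<phi> \<psi>) \<subseteq> D \<and>
      transports P n (Disj \<phi> \<psi>) T V s D"
    by (intro exI[of _ ?D] conjI)
qed

lemma witnessed_Conj:
  assumes "witnessed P n k \<phi>" "witnessed P n k \<psi>"
  shows "witnessed P n (k + k) (Conj \<phi> \<psi>)"
proof (rule witnessedI)
  fix T V s assume A: "finite_tree T V" "range s \<subseteq> T" "sat T V s (Conj \<phi> \<psi>)"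
  then have sat: "sat T V s \<phi>" "sat T V s \<psi>" by simp_all
  obtain D where D: "D \<subseteq> T" "card D \<le> k" "s ` fv \<phi> \<subseteq> D" "transports P n \<phi> T V s D"
    using witnessedD[OF assms(1) A(1,2) sat(1)] by blast
  obtain E where E: "E \<subseteq> T" "card E \<le> k" "s ` fv \<psi> \<subseteq> E" "transports P n \<psi> T V s E"
    using witnessedD[OF assms(2) A(1,2) sat(2)] by blast
  have "card (D \<union> E) \<le> k + k" using card_Un_le[of D E] D(2) E(2) by linarith
  moreover have "transports P n \<phi> T V s (D \<union> E)" "transports P n \<psi> T V s (D \<union> E)"
    by (rule transports_mono[OF D(4) A(1)] transports_mono[OF E(4) A(1)]; simp)+
  then have "transports P n (Conj \<phi> \<psi>) T V s (D \<union> E)"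
    unfolding transports_def sat.simps by meson
  moreover have "D \<union> E \<subseteq> T" "s ` fv (Conj \<phi> \<psi>) \<subseteq> D \<union> E" using D(1,3) E(1,3) by auto
  ultimately show "\<exists>D\<subseteq>T. card D \<le> k + k \<and> s ` fv (Conj \<phi> \<psi>) \<subseteq> D \<and>
      transports P n (Conj \<phi> \<psi>) T V s D"
    by (intro exI[of _ "D \<union> E"] conjI)
qed

lemma witnessed_Ex:
  assumes "witnessed P n k \<phi>"
  shows "witnessed P n (Suc k) (Ex x \<phi>)"
proof (rule witnessedI)
  fix T V s assume A: "finite_tree T V" "range s \<subseteq> T" "sat T V s (Ex x \<phi>)"
  then obtain a where a: "a \<in> T" "sat T V (s(x := a)) \<phi>" by auto
  have ran: "range (s(x := a)) \<subseteq> T" using A(2) a(1) by auto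
  obtain D where D: "D \<subseteq> T" "card D \<le> k" "(s(x := a)) ` fv \<phi> \<subseteq> D"
    "transports P n \<phi> T V (s(x := a)) D"
    using witnessedD[OF assms A(1) ran a(2)] by blast
  have "card (insert a D) \<le> Suc k"
    using D(2) card_insert_le_m1[of "Suc k" D a] by simp
  moreover have "transports P n (Ex x \<phi>) T V s (insert a D)"
  proof (rule transportsI)
    fix T' V' h
    assume T': "finite_tree T' V'" and h: "tree_pair.homomorphism P (\<lambda>_. 1) T V T' V' n h (insert a D)"
    interpret tree_pair P "\<lambda>_. 1" T V T' V' by (rule tree_pairI[OF A(1) T'])
    have "sat T' V' (h \<circ> s(x := a)) \<phi>"
      by (rule transportsD[OF D(4) T' homomorphism_subset[OF h]]) auto
    moreover have "h \<circ> s(x := a) = (h \<circ> s)(x := h a)" by auto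
    moreover have "h a \<in> T'" using h[unfolded homomorphism_def] by simp
    ultimately show "sat T' V' (h \<circ> s) (Ex x \<phi>)" by auto
  qed
  moreover have "insert a D \<subseteq> T" "s ` fv (Ex x \<phi>) \<subseteq> insert a D" using D(1,3) a(1) by auto
  ultimately show "\<exists>D\<subseteq>T. card D \<le> Suc k \<and> s ` fv (Ex x \<phi>) \<subseteq> D \<and> transports P n (Ex x \<phi>) T V s D"
    by (intro exI[of _ "insert a D"] conjI)
qed

text \<open>A homomorphism from the witnesses of \<open>\<phi>\<close> in \<open>T'\<close> back to \<open>T\<close> carries \<open>\<phi>\<close> over to \<open>T\<close>;
  since \<open>\<phi>\<close> has at most one free variable, it suffices that this homomorphism fixes one point.\<close>

lemma witnessed_transfer:
  assumes "witnessed P n k \<phi>" "fv \<phi> \<subseteq> {z}" "finite_tree T V" "finite_tree T' V'" "a \<in> T" "a' \<in> T'"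
    and "agree (probes P (\<lambda>_. 1) (n + 2 * k + 1)) (T, V, a) (T', V', a')"
    and "sat T V (\<lambda>_. a) \<phi>"
  shows "sat T' V' (\<lambda>_. a') \<phi>"
proof -
  interpret tree_pair P "\<lambda>_. 1" T V T' V' by (rule tree_pairI[OF assms(3,4)])
  have ran: "range (\<lambda>_. a) \<subseteq> T" using assms(5) by auto
  obtain D where D: "D \<subseteq> T" "card D \<le> k" "transports P n \<phi> T V (\<lambda>_. a) D"
    using witnessedD[OF assms(1,3) ran assms(8)] by blast
  have "sim (n + 2 * k + 1) a a'" unfolding sim_def by (fact assms(7))
  from homomorphism_any[OF this assms(5,6) D(1,2)] obtain h where
    h: "homomorphism n h (insert a D)" "h a = a'" by blast
  have "sat T' V' (h \<circ> (\<lambda>_. a)) \<phi>"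
    by (rule transportsD[OF D(3) assms(4) homomorphism_subset[OF h(1)]]) auto
  then show ?thesis using h(2) by (simp add: comp_def)
qed

text \<open>Homomorphisms cannot be reversed, but agreement of types at the single point
  \<open>s z\<close> can: if \<phi> held at the image, \<open>witnessed_transfer\<close> would carry
  it back to \<open>s z\<close>. The new level is the one required for that; the witnesses of \<phi>
  are then forgotten and one point remains.\<close>

lemma witnessed_Neg:
  assumes "witnessed P n k \<phi>" "fv \<phi> \<subseteq> {z}"
  shows "witnessed P (n + 2 * k + 1) 1 (Neg \<phi>)"
proof (rule witnessedI)
  fix T V s assume A: "finite_tree T V" "range s \<subseteq> T" "sat T V s (Neg \<phi>)"
  have "transports P (n + 2 * k + 1) (Neg \<phi>) T V s {s z}"
  proof (rule transportsI)
    fix T' V' h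
    assume T': "finite_tree T' V'"
      and h: "tree_pair.homomorphism P (\<lambda>_. 1) T V T' V' (n + 2 * k + 1) h {s z}"
    interpret tree_pair P "\<lambda>_. 1" T V T' V' by (rule tree_pairI[OF A(1) T'])
    have *: "s z \<in> T" "h (s z) \<in> T'" "sim (n + 2 * k + 1) (s z) (h (s z))"
      using h unfolding homomorphism_def by blast+
    have "sat T V (\<lambda>_. s z) \<phi> \<longleftrightarrow> sat T V s \<phi>"
      by (rule sat_cong) (use assms(2) in auto)
    then have "\<not> sat T' V' (\<lambda>_. h (s z)) \<phi>"
      using witnessed_transfer[OF assms T' A(1) *(2,1) agree_sym[OF *(3)[unfolded sim_def]]] A(3) by auto
    moreover have "sat T' V' (\<lambda>_. h (s z)) \<phi> \<longleftrightarrow> sat T' V' (h \<circ> s) \<phi>"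
      by (rule sat_cong) (use assms(2) in auto)
    ultimately show "sat T' V' (h \<circ> s) (Neg \<phi>)" by simp
  qed
  moreover have "{s z} \<subseteq> T" "s ` fv (Neg \<phi>) \<subseteq> {s z}" "card {s z} \<le> 1"
    using A(2) assms(2) by auto
  ultimately show "\<exists>D\<subseteq>T. card D \<le> 1 \<and> s ` fv (Neg \<phi>) \<subseteq> D \<and>
      transports P (n + 2 * k + 1) (Neg \<phi>) T V s D"
    by (intro exI[of _ "{s z}"] conjI)
qed

lemma UNFO_witnessed: "\<phi> \<in> UNFO_fmls \<Longrightarrow> preds \<phi> \<subseteq> P \<Longrightarrow> \<exists>n k. witnessed P n k \<phi>"
proof (induction rule: UNFO_fmls.induct)
  case (atom \<phi>)
  then show ?case using witnessed_atomic by blast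
next
  case (disj \<phi> \<psi>)
  then obtain n k n' k' where "witnessed P n k \<phi>" "witnessed P n' k' \<psi>" by auto
  then have "witnessed P (n + n') (k + k') \<phi>" "witnessed P (n + n') (k + k') \<psi>"
    by (auto elim: witnessed_mono)
  then show ?case using witnessed_Disj by blast
next
  case (conj \<phi> \<psi>)
  then obtain n k n' k' where "witnessed P n k \<phi>" "witnessed P n' k' \<psi>" by auto
  then have "witnessed P (n + n') (k + k') \<phi>" "witnessed P (n + n') (k + k') \<psi>"
    by (auto elim: witnessed_mono)
  then show ?case using witnessed_Conj by blast
next
  case (ex \<phi> x)
  then show ?case using witnessed_Ex by fastforce
next
  case (neg \<phi>)
  then obtain n k where "witnessed P n k \<phi>" by auto
  \<comment> \<open>Sentences are included: for them any \<open>z\<close> will do.\<close>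
  moreover have "\<forall>x\<in>fv \<phi>. \<forall>y\<in>fv \<phi>. x = y"
    using neg.hyps(2) card_le_Suc0_iff_eq[OF finite_fv, of \<phi>] by simp
  then obtain z where "fv \<phi> \<subseteq> {z}" by blast
  ultimately show ?case using witnessed_Neg by blast
qed

section \<open>Ungraded types expressed in Core XPath\<close>

lemma dia_1: "finite T \<Longrightarrow> dia 1 R f (T, V, a) \<longleftrightarrow> (\<exists>b\<in>T. R a b \<and> f (T, V, b))"
proof -
  assume "finite T"
  then have "card {b \<in> T. R a b \<and> f (T, V, b)} = 0 \<longleftrightarrow> {b \<in> T. R a b \<and> f (T, V, b)} = {}"
    by simp
  then show ?thesis by (auto simp: Suc_le_eq)
qed

definition valid :: "'p pointed \<Rightarrow> bool" where
  "valid = (\<lambda>(T, V, a). finite_tree T V \<and> a \<in> T)"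

text \<open>One modal formula has to work for all pairs of distinct variables, because
  \<open>st\<close> exchanges the two under each modality.\<close>

definition CoreXPath_definable :: "'p set \<Rightarrow> ('p pointed \<Rightarrow> bool) set" where
  "CoreXPath_definable P = {f. \<exists>\<phi>. set_cxpath \<phi> \<subseteq> P \<and> (\<forall>T V s x y. finite_tree T V \<longrightarrow> x \<noteq> y \<longrightarrow>
     s x \<in> T \<longrightarrow> (sat T V s (st x y \<phi>) \<longleftrightarrow> f (T, V, s x)))}"

lemma CoreXPath_definableI:
  assumes "set_cxpath \<phi> \<subseteq> P"
    and "\<And>T V s x y. finite_tree T V \<Longrightarrow> x \<noteq> y \<Longrightarrow> s x \<in> T \<Longrightarrow>
      sat T V s (st x y \<phi>) \<longleftrightarrow> f (T, V, s x)"
  shows "f \<in> CoreXPath_definable P"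
  using assms unfolding CoreXPath_definable_def by blast

lemma CoreXPath_definableE:
  assumes "f \<in> CoreXPath_definable P"
  obtains \<phi> where "set_cxpath \<phi> \<subseteq> P"
    "\<And>T V s x y. finite_tree T V \<Longrightarrow> x \<noteq> y \<Longrightarrow> s x \<in> T \<Longrightarrow>
      sat T V s (st x y \<phi>) \<longleftrightarrow> f (T, V, s x)"
  using assms unfolding CoreXPath_definable_def by blast

lemma modal_closed_CoreXPath:
  fixes P :: "'p set"
  assumes "finite P"
  shows "modal_closed (CoreXPath_definable P) P (\<lambda>_. 1)"
proof
  show "(\<lambda>_. True) \<in> CoreXPath_definable P"
    by (rule CoreXPath_definableI[of XTrue]) auto
  show "(\<lambda>x. \<not> f x) \<in> CoreXPath_definable P" if f: "f \<in> CoreXPath_definable P" for f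
    by (rule CoreXPath_definableE[OF f], rule_tac \<phi> = "XNot \<phi>" in CoreXPath_definableI) auto
  show "(\<lambda>x. f x \<and> g x) \<in> CoreXPath_definable P"
    if f: "f \<in> CoreXPath_definable P" and g: "g \<in> CoreXPath_definable P" for f g
  proof -
    obtain \<phi> where 1: "set_cxpath \<phi> \<subseteq> P"
      "\<And>T V s x y. finite_tree T V \<Longrightarrow> x \<noteq> y \<Longrightarrow> s x \<in> T \<Longrightarrow> sat T V s (st x y \<phi>) \<longleftrightarrow> f (T, V, s x)"
      by (rule CoreXPath_definableE[OF f]) blast
    obtain \<psi> where 2: "set_cxpath \<psi> \<subseteq> P"
      "\<And>T V s x y. finite_tree T V \<Longrightarrow> x \<noteq> y \<Longrightarrow> s x \<in> T \<Longrightarrow> sat T V s (st x y \<psi>) \<longleftrightarrow> g (T, V, s x)"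
      by (rule CoreXPath_definableE[OF g]) blast
    show ?thesis
      by (rule CoreXPath_definableI[of "XAnd \<phi> \<psi>"]) (use 1 2 in auto)
  qed
  show "finite P" by fact
  show "(\<lambda>(T, V, a). a \<in> V p) \<in> CoreXPath_definable P" if "p \<in> P" for p
    by (rule CoreXPath_definableI[of "XProp p"]) (use that in auto)
  show "dia C R f \<in> CoreXPath_definable P"
    if "1 \<le> C" "C \<le> 1" "R \<in> rels" and f: "f \<in> CoreXPath_definable P" for C R f
  proof -
    have C: "C = 1" using that by simp
    obtain \<phi> where phi: "set_cxpath \<phi> \<subseteq> P"
      "\<And>T V s x y. finite_tree T V \<Longrightarrow> x \<noteq> y \<Longrightarrow> s x \<in> T \<Longrightarrow> sat T V s (st x y \<phi>) \<longleftrightarrow> f (T, V, s x)"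
      by (rule CoreXPath_definableE[OF f]) blast
    have step: "sat T V s (Ex y (Conj \<alpha> (st y x \<phi>))) \<longleftrightarrow> dia C R f (T, V, s x)"
      if "finite_tree T V" "x \<noteq> y" "\<And>b. sat T V (s(y := b)) \<alpha> \<longleftrightarrow> R (s x) b" for T V s x y \<alpha>
    proof -
      have "sat T V (s(y := b)) (st y x \<phi>) \<longleftrightarrow> f (T, V, b)" if "b \<in> T" for b
        using phi(2)[of T V y x "s(y := b)"] that \<open>finite_tree T V\<close> \<open>x \<noteq> y\<close> by simp
      then show ?thesis
        unfolding C dia_1[OF tree_finite[OF that(1)]] using that(3) by auto
    qed
    from \<open>R \<in> rels\<close> consider "R = child" | "R = child\<inverse>\<inverse>" | "R = strict_prefix" | "R = strict_prefix\<inverse>\<inverse>"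
      by (auto simp: rels_def)
    then show ?thesis
    proof cases
      case 1
      show ?thesis
        by (rule CoreXPath_definableI[of "XChild \<phi>"])
          (use phi(1) 1 in \<open>simp_all del: sat.simps(8) dia.simps add: step\<close>)
    next
      case 2
      show ?thesis
        by (rule CoreXPath_definableI[of "XParent \<phi>"])
          (use phi(1) 2 in \<open>simp_all del: sat.simps(8) dia.simps add: step\<close>)
    next
      case 3
      show ?thesis
        by (rule CoreXPath_definableI[of "XDesc \<phi>"])
          (use phi(1) 3 in \<open>simp_all del: sat.simps(8) dia.simps add: step descendant_eq\<close>)
    next
      case 4
      show ?thesis
        by (rule CoreXPath_definableI[of "XAnc \<phi>"])
          (use phi(1) 4 in \<open>simp_all del: sat.simps(8) dia.simps add: step descendant_eq\<close>)
    qed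
  qed
qed

lemma fv_st: "x \<noteq> y \<Longrightarrow> fv (st x y \<phi>) = {x}"
  by (induction x y \<phi> rule: st.induct) auto

lemma vars_st: "vars (st x y \<phi>) \<subseteq> {x, y}"
  by (induction x y \<phi> rule: st.induct) auto

lemma preds_st: "preds (st x y \<phi>) = set_cxpath \<phi>"
  by (induction x y \<phi> rule: st.induct) auto

lemma counting_free_st: "counting_free (st x y \<phi>)"
  by (induction x y \<phi> rule: st.induct) auto

lemma st_UNFO: "x \<noteq> y \<Longrightarrow> st x y \<phi> \<in> UNFO_fmls"
  by (induction x y \<phi> rule: st.induct)
    (simp_all add: UNFO_fmls.disj UNFO_fmls.conj UNFO_fmls.ex UNFO_fmls.neg UNFO_fmls.atom fv_st)

lemma st_GF: "x \<noteq> y \<Longrightarrow> st x y \<phi> \<in> GF_fmls"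
proof (induction x y \<phi> rule: st.induct)
  case (6 x y \<phi>)
  then show ?case
    using GF_fmls.ex[of "st y x \<phi>" "Child x y" "[y]"] by (simp add: exs_def fv_st)
next
  case (7 x y \<phi>)
  then show ?case
    using GF_fmls.ex[of "st y x \<phi>" "Child y x" "[y]"] by (simp add: exs_def fv_st)
next
  case (8 x y \<phi>)
  then show ?case
    using GF_fmls.ex[of "st y x \<phi>" "Desc x y" "[y]"] by (simp add: exs_def fv_st)
next
  case (9 x y \<phi>)
  then show ?case
    using GF_fmls.ex[of "st y x \<phi>" "Desc y x" "[y]"] by (simp add: exs_def fv_st)
qed (auto intro: GF_fmls.intros)

text \<open>The modal formula comes from \<open>invariant_definable\<close>, as a disjunction of
  types; invariance at some finite depth is thus all that remains to be shown for a logic.\<close>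

lemma CoreXPath_complete:
  fixes \<phi> :: "'p fo"
  assumes "finite P"
    and "\<And>T V a T' V' a'. finite_tree T V \<Longrightarrow> a \<in> T \<Longrightarrow> finite_tree T' V' \<Longrightarrow> a' \<in> T' \<Longrightarrow>
      agree (probes P (\<lambda>_. 1) n) (T, V, a) (T', V', a') \<Longrightarrow>
      holds_at T V a \<phi> \<longleftrightarrow> holds_at T' V' a' \<phi>"
  shows "\<exists>\<psi>\<in>CoreXPath P. one_free \<psi> \<and> tree_equiv \<phi> \<psi>"
proof -
  interpret modal_closed "CoreXPath_definable P" P "\<lambda>_. 1"
    by (rule modal_closed_CoreXPath) fact
  obtain g where g: "g \<in> CoreXPath_definable P"
    "\<forall>r. valid r \<longrightarrow> (g r \<longleftrightarrow> (\<lambda>(T, V, a). holds_at T V a \<phi>) r)"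
    using invariant_definable[of valid n "\<lambda>(T, V, a). holds_at T V a \<phi>"] assms(2)
    by (auto simp: valid_def)
  obtain \<chi> where chi: "set_cxpath \<chi> \<subseteq> P"
    "\<And>T V s x y. finite_tree T V \<Longrightarrow> x \<noteq> y \<Longrightarrow> s x \<in> T \<Longrightarrow> sat T V s (st x y \<chi>) \<longleftrightarrow> g (T, V, s x)"
    by (rule CoreXPath_definableE[OF g(1)]) blast
  have "tree_equiv \<phi> (st 0 1 \<chi>)"
    using g(2) chi(2)[of _ _ 0 1] by (auto simp: tree_equiv_def holds_at_def valid_def)
  then show ?thesis
    using chi(1) by (intro bexI[of _ "st 0 1 \<chi>"]) (auto simp: CoreXPath_def preds_st one_free_def fv_st)
qed

lemma UNFO_le_CoreXPath: "finite P \<Longrightarrow> UNFO P \<preceq>\<^sub>e CoreXPath P"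
  unfolding expr_le_def
proof (intro ballI impI)
  fix \<phi> assume "finite P" and phi: "\<phi> \<in> UNFO P" "one_free \<phi>"
  then obtain n k where w: "witnessed P n k \<phi>" using UNFO_witnessed[of \<phi> P] by (auto simp: UNFO_def)
  obtain z where z: "fv \<phi> \<subseteq> {z}" using phi(2) by (auto simp: one_free_def)
  show "\<exists>\<psi>\<in>CoreXPath P. one_free \<psi> \<and> tree_equiv \<phi> \<psi>"
  proof (rule CoreXPath_complete[OF \<open>finite P\<close>])
    fix T V a T' V' a'
    assume *: "finite_tree T V" "a \<in> T" "finite_tree T' V'" "a' \<in> T'"
      "agree (probes P (\<lambda>_. 1) (n + 2 * k + 1)) (T, V, a) (T', V', a')"
    show "holds_at T V a \<phi> \<longleftrightarrow> holds_at T' V' a' \<phi>"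
      unfolding holds_at_def
      using witnessed_transfer[OF w z *(1,3,2,4,5)]
        witnessed_transfer[OF w z *(3,1,4,2) agree_sym[OF *(5)]] by blast
  qed
qed

lemma invariant_holds_at:
  assumes "invariant P G n \<phi>" "finite_tree T V" "a \<in> T" "finite_tree T' V'" "a' \<in> T'"
    "agree (probes P G n) (T, V, a) (T', V', a')"
  shows "holds_at T V a \<phi> \<longleftrightarrow> holds_at T' V' a' \<phi>"
  unfolding holds_at_def
  by (rule invariantD[OF assms(1,2,4)]) (use assms same_pos_refl in auto)

lemma GF2_le_CoreXPath: "finite P \<Longrightarrow> GF2 P \<preceq>\<^sub>e CoreXPath P"
  unfolding expr_le_def
proof (intro ballI impI)
  fix \<phi> assume "finite P" and phi: "\<phi> \<in> GF2 P"
  then obtain n where "invariant P (\<lambda>_. 1) n \<phi>"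
    using GF_invariant[of "\<lambda>_. 1" \<phi> P] by (auto simp: GF2_def)
  from invariant_holds_at[OF this] CoreXPath_complete[OF \<open>finite P\<close>]
  show "\<exists>\<psi>\<in>CoreXPath P. one_free \<psi> \<and> tree_equiv \<phi> \<psi>" by blast
qed

lemma expr_le_subset: "L1 \<subseteq> L2 \<Longrightarrow> L1 \<preceq>\<^sub>e L2"
  unfolding expr_le_def tree_equiv_def by blast

lemma expr_le_trans: "L1 \<preceq>\<^sub>e L2 \<Longrightarrow> L2 \<preceq>\<^sub>e L3 \<Longrightarrow> L1 \<preceq>\<^sub>e L3"
  unfolding expr_le_def tree_equiv_def by meson

lemma CoreXPath_subset: "CoreXPath P \<subseteq> GF2 P" "CoreXPath P \<subseteq> UNFO P" "CoreXPath P \<subseteq> FO2 P"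
  using vars_st[of 0 1]
  by (auto simp: CoreXPath_def GF2_def UNFO_def FO2_def st_GF st_UNFO counting_free_st)

section \<open>Graded types expressed with two variables and counting\<close>

definition C2_definable :: "'p set \<Rightarrow> ('p pointed \<Rightarrow> bool) set" where
  "C2_definable P = {f. \<forall>x y. {x, y} = {0, 1} \<longrightarrow> (\<exists>\<phi>. fv \<phi> = {x} \<and> vars \<phi> \<subseteq> {0, 1} \<and> preds \<phi> \<subseteq> P \<and>
     (\<forall>T V s. finite_tree T V \<longrightarrow> s x \<in> T \<longrightarrow> (sat T V s \<phi> \<longleftrightarrow> f (T, V, s x))))}"

lemma C2_definableI:
  assumes "\<And>x y. {x, y} = {0, 1} \<Longrightarrow> \<exists>\<phi>. fv \<phi> = {x} \<and> vars \<phi> \<subseteq> {0, 1} \<and> preds \<phi> \<subseteq> P \<and>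
     (\<forall>T V s. finite_tree T V \<longrightarrow> s x \<in> T \<longrightarrow> (sat T V s \<phi> \<longleftrightarrow> f (T, V, s x)))"
  shows "f \<in> C2_definable P"
  unfolding C2_definable_def mem_Collect_eq by (intro allI impI) (rule assms)

lemma C2_definableE:
  assumes "f \<in> C2_definable P" "{x, y} = {0, 1}"
  obtains \<phi> where "fv \<phi> = {x}" "vars \<phi> \<subseteq> {0, 1}" "preds \<phi> \<subseteq> P"
    "\<And>T V s. finite_tree T V \<Longrightarrow> s x \<in> T \<Longrightarrow> sat T V s \<phi> \<longleftrightarrow> f (T, V, s x)"
proof -
  have "\<exists>\<phi>. fv \<phi> = {x} \<and> vars \<phi> \<subseteq> {0, 1} \<and> preds \<phi> \<subseteq> P \<and>
     (\<forall>T V s. finite_tree T V \<longrightarrow> s x \<in> T \<longrightarrow> (sat T V s \<phi> \<longleftrightarrow> f (T, V, s x)))"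
    using assms(1)[unfolded C2_definable_def mem_Collect_eq, rule_format, OF assms(2)] .
  then show thesis using that by blast
qed

text \<open>A graded modality becomes a counting quantifier over the other variable. Since the
  variables change roles at each nesting, a property must be definable at either of them.\<close>

lemma modal_closed_C2:
  fixes P :: "'p set"
  assumes "finite P"
  shows "modal_closed (C2_definable P) P Suc"
proof
  show "(\<lambda>_. True) \<in> C2_definable P"
  proof (rule C2_definableI)
    fix x y :: nat assume "{x, y} = {0, 1}"
    then show "\<exists>\<phi>. fv \<phi> = {x} \<and> vars \<phi> \<subseteq> {0, 1} \<and> preds \<phi> \<subseteq> P \<and>
     (\<forall>T V s. finite_tree T V \<longrightarrow> s x \<in> T \<longrightarrow> (sat T V s \<phi> \<longleftrightarrow> True))"
      by (intro exI[of _ "Equal x x"]) auto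
  qed
  show "(\<lambda>x. \<not> f x) \<in> C2_definable P" if f: "f \<in> C2_definable P" for f
  proof (rule C2_definableI)
    fix x y :: nat assume xy: "{x, y} = {0, 1}"
    obtain \<phi> where "fv \<phi> = {x}" "vars \<phi> \<subseteq> {0, 1}" "preds \<phi> \<subseteq> P"
      "\<And>T V s. finite_tree T V \<Longrightarrow> s x \<in> T \<Longrightarrow> sat T V s \<phi> \<longleftrightarrow> f (T, V, s x)"
      by (rule C2_definableE[OF f xy]) blast
    then show "\<exists>\<phi>. fv \<phi> = {x} \<and> vars \<phi> \<subseteq> {0, 1} \<and> preds \<phi> \<subseteq> P \<and>
     (\<forall>T V s. finite_tree T V \<longrightarrow> s x \<in> T \<longrightarrow> (sat T V s \<phi> \<longleftrightarrow> \<not> f (T, V, s x)))"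
      by (intro exI[of _ "Neg \<phi>"]) simp
  qed
  show "(\<lambda>x. f x \<and> g x) \<in> C2_definable P"
    if f: "f \<in> C2_definable P" and g: "g \<in> C2_definable P" for f g
  proof (rule C2_definableI)
    fix x y :: nat assume xy: "{x, y} = {0, 1}"
    obtain \<phi> where 1: "fv \<phi> = {x}" "vars \<phi> \<subseteq> {0, 1}" "preds \<phi> \<subseteq> P"
      "\<And>T V s. finite_tree T V \<Longrightarrow> s x \<in> T \<Longrightarrow> sat T V s \<phi> \<longleftrightarrow> f (T, V, s x)"
      by (rule C2_definableE[OF f xy]) blast
    obtain \<psi> where 2: "fv \<psi> = {x}" "vars \<psi> \<subseteq> {0, 1}" "preds \<psi> \<subseteq> P"
      "\<And>T V s. finite_tree T V \<Longrightarrow> s x \<in> T \<Longrightarrow> sat T V s \<psi> \<longleftrightarrow> g (T, V, s x)"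
      by (rule C2_definableE[OF g xy]) blast
    show "\<exists>\<phi>. fv \<phi> = {x} \<and> vars \<phi> \<subseteq> {0, 1} \<and> preds \<phi> \<subseteq> P \<and>
     (\<forall>T V s. finite_tree T V \<longrightarrow> s x \<in> T \<longrightarrow> (sat T V s \<phi> \<longleftrightarrow> f (T, V, s x) \<and> g (T, V, s x)))"
      by (intro exI[of _ "Conj \<phi> \<psi>"]) (simp add: 1(1,3,4) 2(1,3,4), use 1(2) 2(2) in simp)
  qed
  show "finite P" by fact
  show "(\<lambda>(T, V, a). a \<in> V p) \<in> C2_definable P" if "p \<in> P" for p
  proof (rule C2_definableI)
    fix x y :: nat assume "{x, y} = {0, 1}"
    then show "\<exists>\<phi>. fv \<phi> = {x} \<and> vars \<phi> \<subseteq> {0, 1} \<and> preds \<phi> \<subseteq> P \<and>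
     (\<forall>T V s. finite_tree T V \<longrightarrow> s x \<in> T \<longrightarrow> (sat T V s \<phi> \<longleftrightarrow>
        (case (T, V, s x) of (T, V, a) \<Rightarrow> a \<in> V p)))"
      using that by (intro exI[of _ "Pred p x"]) auto
  qed
  show "dia C R f \<in> C2_definable P" if "R \<in> rels" and f: "f \<in> C2_definable P" for C R f
  proof (rule C2_definableI)
    fix x y :: nat assume xy: "{x, y} = {0, 1}"
    then have yx: "{y, x} = {0, 1}" by (subst insert_commute)
    have "x \<noteq> y" using xy unfolding doubleton_eq_iff by auto
    obtain \<phi> where phi: "fv \<phi> = {y}" "vars \<phi> \<subseteq> {0, 1}" "preds \<phi> \<subseteq> P"
      "\<And>T V s. finite_tree T V \<Longrightarrow> s y \<in> T \<Longrightarrow> sat T V s \<phi> \<longleftrightarrow> f (T, V, s y)"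
      by (rule C2_definableE[OF f yx]) blast
    have "\<exists>\<alpha>::'p fo. fv \<alpha> = {x, y} \<and> vars \<alpha> = {x, y} \<and> preds \<alpha> = {} \<and>
        (\<forall>T V s. sat T V s \<alpha> \<longleftrightarrow> R (s x) (s y))"
      using \<open>R \<in> rels\<close> unfolding rels_def
    proof (elim insertE emptyE)
      assume "R = child"
      then show ?thesis by (intro exI[of _ "Child x y"]) simp
    next
      assume "R = child\<inverse>\<inverse>"
      then show ?thesis by (intro exI[of _ "Child y x"]) auto
    next
      assume "R = strict_prefix"
      then show ?thesis by (intro exI[of _ "Desc x y"]) (simp add: descendant_eq)
    next
      assume "R = strict_prefix\<inverse>\<inverse>"
      then show ?thesis by (intro exI[of _ "Desc y x"]) (auto simp: descendant_eq)
    qed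
    then obtain \<alpha> :: "'p fo" where alpha: "fv \<alpha> = {x, y}" "vars \<alpha> = {x, y}" "preds \<alpha> = {}"
      "\<And>T V s. sat T V s \<alpha> \<longleftrightarrow> R (s x) (s y)" by blast
    have "sat T V s (AtLeast C y (Conj \<alpha> \<phi>)) \<longleftrightarrow> dia C R f (T, V, s x)" if "finite_tree T V" for T V s
    proof -
      have "{b \<in> T. sat T V (s(y := b)) (Conj \<alpha> \<phi>)} = {b \<in> T. R (s x) b \<and> f (T, V, b)}"
        using phi(4)[OF that, of "s(y := _)"] alpha(4) \<open>x \<noteq> y\<close> by auto
      then show ?thesis by simp
    qed
    moreover have "fv (AtLeast C y (Conj \<alpha> \<phi>)) = {x}"
      using phi(1) alpha(1) \<open>x \<noteq> y\<close> by auto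
    moreover have "vars (AtLeast C y (Conj \<alpha> \<phi>)) \<subseteq> {0, 1}"
      using phi(2) alpha(2) unfolding xy[symmetric] by simp
    moreover have "preds (AtLeast C y (Conj \<alpha> \<phi>)) \<subseteq> P"
      using phi(3) alpha(3) by simp
    ultimately show "\<exists>\<phi>. fv \<phi> = {x} \<and> vars \<phi> \<subseteq> {0, 1} \<and> preds \<phi> \<subseteq> P \<and>
     (\<forall>T V s. finite_tree T V \<longrightarrow> s x \<in> T \<longrightarrow> (sat T V s \<phi> \<longleftrightarrow> dia C R f (T, V, s x)))"
      by (intro exI[of _ "AtLeast C y (Conj \<alpha> \<phi>)"] conjI allI impI)
  qed
qed

lemma F1_le_C2: "finite P \<Longrightarrow> F1 P \<preceq>\<^sub>e C2 P"
  unfolding expr_le_def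
proof (intro ballI impI)
  fix \<phi> assume "finite P" and phi: "\<phi> \<in> F1 P"
  then obtain n where n: "invariant P Suc n \<phi>"
    using F1_invariant[of \<phi> P] by (auto simp: F1_def)
  interpret modal_closed "C2_definable P" P Suc
    by (rule modal_closed_C2) fact
  obtain g where g: "g \<in> C2_definable P"
    "\<forall>r. valid r \<longrightarrow> (g r \<longleftrightarrow> (\<lambda>(T, V, a). holds_at T V a \<phi>) r)"
    using invariant_definable[of valid n "\<lambda>(T, V, a). holds_at T V a \<phi>"] invariant_holds_at[OF n]
    by (auto simp: valid_def)
  obtain \<psi> where psi: "fv \<psi> = {0}" "vars \<psi> \<subseteq> {0, 1}" "preds \<psi> \<subseteq> P"
    "\<And>T V s. finite_tree T V \<Longrightarrow> s 0 \<in> T \<Longrightarrow> sat T V s \<psi> \<longleftrightarrow> g (T, V, s 0)"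
    by (rule C2_definableE[OF g(1), of 0 1]) auto
  have "tree_equiv \<phi> \<psi>"
    using g(2) psi(4) by (auto simp: tree_equiv_def holds_at_def valid_def)
  then show "\<exists>\<psi>\<in>C2 P. one_free \<psi> \<and> tree_equiv \<phi> \<psi>"
    using psi(1-3) by (intro bexI[of _ \<psi>]) (auto simp: C2_def one_free_def)
qed

section \<open>Counting in the one-dimensional fragment\<close>

text \<open>Working with properties of assignments keeps syntax out of the closure lemmas;
  \<open>X\<close> only bounds the free variables. On finite universes a cardinality bound amounts
  to the existence of an injection.\<close>

definition F1_definable ::
  "'p set \<Rightarrow> nat set \<Rightarrow> (nat list set \<Rightarrow> ('p \<Rightarrow> nat list set) \<Rightarrow> (nat \<Rightarrow> nat list) \<Rightarrow> bool) \<Rightarrow> bool" where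
  "F1_definable P X f \<longleftrightarrow> (\<exists>\<psi>\<in>F1_fmls. preds \<psi> \<subseteq> P \<and> fv \<psi> \<subseteq> X \<and>
     (\<forall>T V s. finite T \<longrightarrow> (sat T V s \<psi> \<longleftrightarrow> f T V s)))"

lemma F1_definableI:
  assumes "\<psi> \<in> F1_fmls" "preds \<psi> \<subseteq> P" "fv \<psi> \<subseteq> X" "\<And>T V s. finite T \<Longrightarrow> sat T V s \<psi> \<longleftrightarrow> f T V s"
  shows "F1_definable P X f"
  using assms unfolding F1_definable_def by (intro bexI[of _ \<psi>]) simp_all

lemma F1_definableE:
  assumes "F1_definable P X f"
  obtains \<psi> where "\<psi> \<in> F1_fmls" "preds \<psi> \<subseteq> P" "fv \<psi> \<subseteq> X"
    "\<And>T V s. finite T \<Longrightarrow> sat T V s \<psi> \<longleftrightarrow> f T V s"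
  using assms unfolding F1_definable_def by auto

lemma F1_definable_subset: "F1_definable P X f \<Longrightarrow> X \<subseteq> Y \<Longrightarrow> F1_definable P Y f"
  by (elim F1_definableE) (rule F1_definableI, auto)

lemma F1_definable_not: "F1_definable P X f \<Longrightarrow> F1_definable P X (\<lambda>T V s. \<not> f T V s)"
  by (elim F1_definableE) (rule F1_definableI[OF F1_fmls.neg], auto)

lemma F1_definable_or:
  assumes "F1_definable P X f" "F1_definable P X g"
  shows "F1_definable P X (\<lambda>T V s. f T V s \<or> g T V s)"
proof -
  obtain \<phi> where 1: "\<phi> \<in> F1_fmls" "preds \<phi> \<subseteq> P" "fv \<phi> \<subseteq> X"
    "\<And>T V s. finite T \<Longrightarrow> sat T V s \<phi> \<longleftrightarrow> f T V s"
    by (rule F1_definableE[OF assms(1)]) blast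
  obtain \<psi> where 2: "\<psi> \<in> F1_fmls" "preds \<psi> \<subseteq> P" "fv \<psi> \<subseteq> X"
    "\<And>T V s. finite T \<Longrightarrow> sat T V s \<psi> \<longleftrightarrow> g T V s"
    by (rule F1_definableE[OF assms(2)]) blast
  show ?thesis
    by (rule F1_definableI[OF F1_fmls.disj[OF 1(1) 2(1)]]) (use 1 2 in auto)
qed

lemma F1_definable_and:
  assumes "F1_definable P X f" "F1_definable P X g"
  shows "F1_definable P X (\<lambda>T V s. f T V s \<and> g T V s)"
  using F1_definable_not[OF F1_definable_or[OF F1_definable_not[OF assms(1)] F1_definable_not[OF assms(2)]]]
  by simp

text \<open>A sentence is used so that its free variables lie in every \<open>X\<close>, even the
  empty one.\<close>

lemma F1_definable_True: "F1_definable P X (\<lambda>T V s. True)"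
proof (rule F1_definableI)
  have "exs [0] (Neg (Equal 0 0)) \<in> F1_fmls"
    by (rule F1_fmls.ex_all) (simp_all add: F1_fmls.neg F1_fmls.atom)
  then show "Neg (exs [0] (Neg (Equal 0 0))) \<in> F1_fmls" by (rule F1_fmls.neg)
qed (auto simp: exs_def)

lemma F1_definable_ball:
  assumes "finite I" "\<And>i. i \<in> I \<Longrightarrow> F1_definable P X (f i)"
  shows "F1_definable P X (\<lambda>T V s. \<forall>i\<in>I. f i T V s)"
  using assms
proof (induction I rule: finite_induct)
  case empty
  then show ?case using F1_definable_True by simp
next
  case (insert i I)
  then have "F1_definable P X (\<lambda>T V s. f i T V s \<and> (\<forall>i\<in>I. f i T V s))"
    by (intro F1_definable_and) auto
  then show ?case by simp
qed

lemma F1_definable_exs: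
  assumes "F1_definable P (insert w (set ys)) f" "distinct (w # ys)"
  shows "F1_definable P {w} (\<lambda>T V s. \<exists>t. (\<forall>y\<in>set ys. t y \<in> T) \<and> (\<forall>y. y \<notin> set ys \<longrightarrow> t y = s y) \<and> f T V t)"
proof -
  obtain \<psi> where psi: "\<psi> \<in> F1_fmls" "preds \<psi> \<subseteq> P" "fv \<psi> \<subseteq> insert w (set ys)"
    "\<And>T V s. finite T \<Longrightarrow> sat T V s \<psi> \<longleftrightarrow> f T V s"
    by (rule F1_definableE[OF assms(1)]) blast
  have "exs ys \<psi> \<in> F1_fmls"
    by (rule F1_fmls.ex_all_but_one[OF psi(1) assms(2)]) (use psi(3) in simp)
  then show ?thesis
    by (rule F1_definableI) (use psi in \<open>auto simp: sat_exs\<close>)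
qed

lemma card_ge_iff_inj_on:
  assumes "finite A" "finite Y"
  shows "card Y \<le> card A \<longleftrightarrow> (\<exists>t. inj_on t Y \<and> t ` Y \<subseteq> A)"
  using assms card_inj_on_le card_le_inj by metis

text \<open>\<open>C\<close> fresh variables name \<open>C\<close> pairwise distinct witnesses and
  are quantified in one block, which leaves only \<open>w\<close> free as one-dimensionality
  demands.\<close>

lemma F1_definable_AtLeast:
  assumes f: "\<And>y. y \<noteq> w \<Longrightarrow> F1_definable P {w, y} (\<lambda>T V s. g T V (s w) (s y))"
  shows "F1_definable P {w} (\<lambda>T V s. C \<le> card {a \<in> T. g T V (s w) a})"
proof -
  have "infinite (- {w})" by (simp add: Compl_eq_Diff_UNIV)
  then obtain Y where Y: "finite Y" "card Y = C" "Y \<subseteq> - {w}"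
    using infinite_arbitrarily_large by blast
  obtain ys where ys: "set ys = Y" "distinct ys"
    using finite_distinct_list[OF Y(1)] by blast
  have "F1_definable P (insert w Y) (\<lambda>T V s. (\<forall>y\<in>Y. g T V (s w) (s y)) \<and>
      (\<forall>y\<in>Y. \<forall>z\<in>Y - {y}. \<not> s y = s z))"
  proof (intro F1_definable_and F1_definable_ball F1_definable_not)
    show "F1_definable P (insert w Y) (\<lambda>T V s. g T V (s w) (s y))" if "y \<in> Y" for y
      by (rule F1_definable_subset[OF f]) (use that Y(3) in auto)
    show "F1_definable P (insert w Y) (\<lambda>T V s. s y = s z)" if "y \<in> Y" "z \<in> Y - {y}" for y z
      by (rule F1_definableI[of "Equal y z"]) (use that in \<open>auto intro: F1_fmls.atom\<close>)
  qed (use Y(1) in auto)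
  then have "F1_definable P {w} (\<lambda>T V s. \<exists>t. (\<forall>y\<in>Y. t y \<in> T) \<and> (\<forall>y. y \<notin> Y \<longrightarrow> t y = s y) \<and>
      (\<forall>y\<in>Y. g T V (t w) (t y)) \<and> (\<forall>y\<in>Y. \<forall>z\<in>Y - {y}. \<not> t y = t z))"
    using F1_definable_exs[of P w ys] ys Y(3) by auto
  then obtain \<psi> where psi: "\<psi> \<in> F1_fmls" "preds \<psi> \<subseteq> P" "fv \<psi> \<subseteq> {w}"
    and sat: "\<And>T V s. finite T \<Longrightarrow> sat T V s \<psi> \<longleftrightarrow>
      (\<exists>t. (\<forall>y\<in>Y. t y \<in> T) \<and> (\<forall>y. y \<notin> Y \<longrightarrow> t y = s y) \<and>
      (\<forall>y\<in>Y. g T V (t w) (t y)) \<and> (\<forall>y\<in>Y. \<forall>z\<in>Y - {y}. \<not> t y = t z))"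
    by (rule F1_definableE) blast
  have "sat T V s \<psi> \<longleftrightarrow> C \<le> card {a \<in> T. g T V (s w) a}" if "finite T" for T V s
  proof -
    have wY: "w \<notin> Y" using Y(3) by auto
    have "finite {a \<in> T. g T V (s w) a}" using that by simp
    from card_ge_iff_inj_on[OF this Y(1)]
    have "C \<le> card {a \<in> T. g T V (s w) a} \<longleftrightarrow>
        (\<exists>t. inj_on t Y \<and> t ` Y \<subseteq> {a \<in> T. g T V (s w) a})" by (simp only: Y(2))
    also have "\<dots> \<longleftrightarrow> sat T V s \<psi>"
      unfolding sat[OF that]
    proof
      assume "\<exists>t. inj_on t Y \<and> t ` Y \<subseteq> {a \<in> T. g T V (s w) a}"
      then obtain t where t: "inj_on t Y" "t ` Y \<subseteq> {a \<in> T. g T V (s w) a}" by blast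
      show "\<exists>t. (\<forall>y\<in>Y. t y \<in> T) \<and> (\<forall>y. y \<notin> Y \<longrightarrow> t y = s y) \<and>
          (\<forall>y\<in>Y. g T V (t w) (t y)) \<and> (\<forall>y\<in>Y. \<forall>z\<in>Y - {y}. \<not> t y = t z)"
        by (rule exI[of _ "\<lambda>y. if y \<in> Y then t y else s y"]) (use t wY in \<open>auto dest: inj_onD\<close>)
    next
      assume "\<exists>t. (\<forall>y\<in>Y. t y \<in> T) \<and> (\<forall>y. y \<notin> Y \<longrightarrow> t y = s y) \<and>
          (\<forall>y\<in>Y. g T V (t w) (t y)) \<and> (\<forall>y\<in>Y. \<forall>z\<in>Y - {y}. \<not> t y = t z)"
      then obtain t where t: "\<forall>y\<in>Y. t y \<in> T" "\<forall>y. y \<notin> Y \<longrightarrow> t y = s y"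
        "\<forall>y\<in>Y. g T V (t w) (t y)" "\<forall>y\<in>Y. \<forall>z\<in>Y - {y}. \<not> t y = t z" by blast
      have "t w = s w" using t(2) wY by blast
      moreover have "inj_on t Y" using t(4) by (auto simp: inj_on_def)
      ultimately show "\<exists>t. inj_on t Y \<and> t ` Y \<subseteq> {a \<in> T. g T V (s w) a}"
        using t(1,3) by (intro exI[of _ t]) auto
    qed
    finally show ?thesis by blast
  qed
  then show ?thesis by (rule F1_definableI[OF psi])
qed

definition pair_assignment :: "'a \<Rightarrow> 'a \<Rightarrow> nat \<Rightarrow> 'a" where
  "pair_assignment a b z = (if z = 0 then a else b)"

lemma fv_subset_vars: "fv \<phi> \<subseteq> vars \<phi>"
  by (induction \<phi>) auto

text \<open>Counting needs many copies of the quantified variable, so the translation is stable under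
  renaming the two variables to arbitrary \<open>u\<close> and \<open>v\<close>.\<close>

lemma F1_definable_count:
  assumes "vars \<phi> \<subseteq> {0, 1}" "x \<in> {0, 1}" "u \<noteq> v"
    and IH: "\<And>u v. u \<noteq> v \<Longrightarrow> F1_definable P {u, v} (\<lambda>T V s. sat T V (pair_assignment (s u) (s v)) \<phi>)"
  shows "F1_definable P {u, v}
    (\<lambda>T V s. C \<le> card {a \<in> T. sat T V ((pair_assignment (s u) (s v))(x := a)) \<phi>})"
proof (cases "x = 0")
  case True
  have "F1_definable P {v} (\<lambda>T V s. C \<le> card {a \<in> T. sat T V (pair_assignment a (s v)) \<phi>})"
    by (rule F1_definable_AtLeast) (use IH in \<open>simp add: insert_commute\<close>)
  moreover have "(pair_assignment b c)(x := a) = pair_assignment a c" for a b c :: "nat list"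
    using True by (auto simp: pair_assignment_def)
  ultimately show ?thesis by (auto elim: F1_definable_subset)
next
  case False
  have "F1_definable P {u} (\<lambda>T V s. C \<le> card {a \<in> T. sat T V (pair_assignment (s u) a) \<phi>})"
    by (rule F1_definable_AtLeast) (use IH in simp)
  moreover have "sat T V ((pair_assignment b c)(x := a)) \<phi> \<longleftrightarrow> sat T V (pair_assignment b a) \<phi>"
    for T V and a b c :: "nat list"
    by (rule sat_cong) (use False assms(1,2) fv_subset_vars[of \<phi>] in \<open>auto simp: pair_assignment_def\<close>)
  ultimately show ?thesis by (auto elim: F1_definable_subset)
qed

lemma F1_definable_cong:
  assumes "F1_definable P X f" "\<And>T V s. finite T \<Longrightarrow> f T V s \<longleftrightarrow> g T V s"
  shows "F1_definable P X g"
  using assms unfolding F1_definable_def by simp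

text \<open>One-dimensionality restricts quantification only, so atoms and Boolean combinations may
  keep both variables. A quantifier over one of two variables leaves at most the other free.\<close>

lemma C2_F1_definable:
  assumes "vars \<phi> \<subseteq> {0, 1}" "u \<noteq> v" "preds \<phi> \<subseteq> P"
  shows "F1_definable P {u, v} (\<lambda>T V s. sat T V (pair_assignment (s u) (s v)) \<phi>)"
  using assms
proof (induction \<phi> arbitrary: u v)
  case (Pred p x)
  then show ?case
    by (intro F1_definableI[of "Pred p (pair_assignment u v x)"])
      (auto intro: F1_fmls.atom simp: pair_assignment_def)
next
  case (Child x y)
  then show ?case
    by (intro F1_definableI[of "Child (pair_assignment u v x) (pair_assignment u v y)"])
      (auto intro: F1_fmls.atom simp: pair_assignment_def)
next
  case (Desc x y)
  then show ?case
    by (intro F1_definableI[of "Desc (pair_assignment u v x) (pair_assignment u v y)"])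
      (auto intro: F1_fmls.atom simp: pair_assignment_def)
next
  case (Equal x y)
  then show ?case
    by (intro F1_definableI[of "Equal (pair_assignment u v x) (pair_assignment u v y)"])
      (auto intro: F1_fmls.atom simp: pair_assignment_def)
next
  case (Neg \<phi>)
  then show ?case using F1_definable_not[OF Neg.IH] by simp
next
  case (Conj \<phi> \<psi>)
  then show ?case using F1_definable_and[OF Conj.IH] by simp
next
  case (Disj \<phi> \<psi>)
  then show ?case using F1_definable_or[OF Disj.IH] by simp
next
  case (Ex x \<phi>)
  have "F1_definable P {u, v}
      (\<lambda>T V s. 1 \<le> card {a \<in> T. sat T V ((pair_assignment (s u) (s v))(x := a)) \<phi>})"
    by (rule F1_definable_count) (use Ex in auto)
  then show ?case
    by (rule F1_definable_cong) (auto simp: Suc_le_eq card_gt_0_iff)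
next
  case (All x \<phi>)
  have neg: "F1_definable P {u, v} (\<lambda>T V s. sat T V (pair_assignment (s u) (s v)) (Neg \<phi>))"
    if "u \<noteq> v" for u v
    unfolding sat.simps by (rule F1_definable_not, rule All.IH) (use All.prems that in auto)
  have "F1_definable P {u, v}
      (\<lambda>T V s. 1 \<le> card {a \<in> T. sat T V ((pair_assignment (s u) (s v))(x := a)) (Neg \<phi>)})"
    by (rule F1_definable_count[OF _ _ _ neg]) (use All.prems in auto)
  then show ?case
    by (rule F1_definable_cong[OF F1_definable_not]) (auto simp: Suc_le_eq card_gt_0_iff)
next
  case (AtLeast C x \<phi>)
  have "F1_definable P {u, v}
      (\<lambda>T V s. C \<le> card {a \<in> T. sat T V ((pair_assignment (s u) (s v))(x := a)) \<phi>})"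
    by (rule F1_definable_count) (use AtLeast in auto)
  then show ?case by simp
next
  case (AtMost C x \<phi>)
  \<comment> \<open>At most \<open>C\<close> is the negation of at least
    \<open>Suc C\<close>.\<close>
  have "F1_definable P {u, v}
      (\<lambda>T V s. Suc C \<le> card {a \<in> T. sat T V ((pair_assignment (s u) (s v))(x := a)) \<phi>})"
    by (rule F1_definable_count) (use AtMost in auto)
  then show ?case
    by (rule F1_definable_cong[OF F1_definable_not]) auto
qed

lemma C2_le_F1: "C2 P \<preceq>\<^sub>e F1 P"
  unfolding expr_le_def
proof (intro ballI impI)
  fix \<phi> assume phi: "\<phi> \<in> C2 P" "one_free \<phi>"
  then obtain z where z: "fv \<phi> = {z}" by (auto simp: one_free_def)
  then have z01: "z \<in> {0, 1}" using phi(1) fv_subset_vars[of \<phi>] by (auto simp: C2_def)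
  define y where "y = 1 - z"
  have "z \<noteq> y" "{0, 1} = {z, y}" using z01 by (auto simp: y_def)
  have "F1_definable P {0, 1} (\<lambda>T V s. sat T V (pair_assignment (s 0) (s 1)) \<phi>)"
    by (rule C2_F1_definable) (use phi(1) in \<open>auto simp: C2_def\<close>)
  then have "F1_definable P (insert z (set [y])) (\<lambda>T V s. sat T V (pair_assignment (s 0) (s 1)) \<phi>)"
    using \<open>{0, 1} = {z, y}\<close> by simp
  \<comment> \<open>The translation may mention both variables, so \<open>y\<close>, which is not
    free in \<phi>, is quantified away; its value does not affect the truth of \<phi>.\<close>
  from F1_definable_exs[OF this] \<open>z \<noteq> y\<close>
  have "F1_definable P {z} (\<lambda>T V s. \<exists>t. (\<forall>x\<in>{y}. t x \<in> T) \<and> (\<forall>x. x \<notin> {y} \<longrightarrow> t x = s x) \<and>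
      sat T V (pair_assignment (t 0) (t 1)) \<phi>)" by simp
  then obtain \<psi> where psi: "\<psi> \<in> F1_fmls" "preds \<psi> \<subseteq> P" "fv \<psi> \<subseteq> {z}" and
    sat: "\<And>T V s. finite T \<Longrightarrow> sat T V s \<psi> \<longleftrightarrow> (\<exists>t. (\<forall>x\<in>{y}. t x \<in> T) \<and>
      (\<forall>x. x \<notin> {y} \<longrightarrow> t x = s x) \<and> sat T V (pair_assignment (t 0) (t 1)) \<phi>)"
    by (rule F1_definableE) blast
  have "sat T V (\<lambda>_. a) \<phi> \<longleftrightarrow> sat T V (\<lambda>_. a) \<psi>" if "finite_tree T V" "a \<in> T" for T V a
  proof -
    have *: "sat T V (pair_assignment (t 0) (t 1)) \<phi> \<longleftrightarrow> sat T V (\<lambda>_. a) \<phi>" if "t z = a" for t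
      by (rule sat_cong) (use that z z01 in \<open>auto simp: pair_assignment_def\<close>)
    show ?thesis
      unfolding sat[OF tree_finite[OF that(1)]]
    proof
      assume "sat T V (\<lambda>_. a) \<phi>"
      then show "\<exists>t. (\<forall>x\<in>{y}. t x \<in> T) \<and> (\<forall>x. x \<notin> {y} \<longrightarrow> t x = a) \<and>
          sat T V (pair_assignment (t 0) (t 1)) \<phi>"
        using *[of "\<lambda>_. a"] that(2) by (intro exI[of _ "\<lambda>_. a"]) simp
    qed (use * \<open>z \<noteq> y\<close> in auto)
  qed
  \<comment> \<open>\<open>one_free\<close> asks for exactly one free variable, whereas \<psi> might
    be a sentence; the false disjunct supplies \<open>z\<close>.\<close>
  then have "tree_equiv \<phi> (Disj \<psi> (Neg (Equal z z)))"
    by (simp add: tree_equiv_def holds_at_def)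
  moreover have "Disj \<psi> (Neg (Equal z z)) \<in> F1 P"
    using psi by (auto simp: F1_def intro!: F1_fmls.disj F1_fmls.neg intro: F1_fmls.atom)
  moreover have "one_free (Disj \<psi> (Neg (Equal z z)))"
    using psi(3) by (auto simp: one_free_def)
  ultimately show "\<exists>\<psi>\<in>F1 P. one_free \<psi> \<and> tree_equiv \<phi> \<psi>" by blast
qed

section \<open>Separations\<close>

definition star_tree :: "nat \<Rightarrow> nat list set" where
  "star_tree n = insert [] ((\<lambda>i. [i]) ` {..<n})"

lemma finite_tree_star: "finite_tree (star_tree n) (\<lambda>_. {})"
  by (auto simp: finite_tree_def star_tree_def)

lemma star_tree_length: "a \<in> star_tree n \<Longrightarrow> length a \<le> 1"
  by (auto simp: star_tree_def)

text \<open>In a star, child and descendant coincide and depend only on the lengths of the two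
  nodes. This lets length serve as the invariant in both separations.\<close>

lemma strict_prefix_length_1:
  assumes "length a \<le> 1" "length b \<le> 1"
  shows "strict_prefix a b \<longleftrightarrow> length a = 0 \<and> length b \<noteq> 0" "child a b \<longleftrightarrow> length a = 0 \<and> length b \<noteq> 0"
  using assms by (cases a; cases b; auto simp: child_def strict_prefix_def)+

lemma star_tree_same_length:
  assumes "a \<in> star_tree m" "0 < n"
  shows "\<exists>b\<in>star_tree n. length b = length a"
  using assms by (auto simp: star_tree_def)

text \<open>The guard depends on lengths only, so any node with the length of the original witness
  is an answer in the other star.\<close>

lemma star_tree_step:
  fixes \<psi> :: "'p fo"
  assumes IH: "\<And>s s'. s y \<in> star_tree m \<Longrightarrow> s' y \<in> star_tree n \<Longrightarrow> length (s y) = length (s' y) \<Longrightarrow>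
      sat (star_tree m) (\<lambda>_. {}) s \<psi> \<longleftrightarrow> sat (star_tree n) (\<lambda>_. {}) s' \<psi>"
    and \<alpha>: "\<alpha> \<in> {Child x y, Child y x, Desc x y, Desc y x}"
    and s: "x \<noteq> y" "s x \<in> star_tree m" "s' x \<in> star_tree n" "length (s x) = length (s' x)" "0 < n"
    and sat: "sat (star_tree m) (\<lambda>_. {}) s (Ex y (Conj \<alpha> \<psi>))"
  shows "sat (star_tree n) (\<lambda>_. {}) s' (Ex y (Conj \<alpha> \<psi>))"
proof -
  obtain b where b: "b \<in> star_tree m" "sat (star_tree m) (\<lambda>_. {}) (s(y := b)) \<alpha>"
    "sat (star_tree m) (\<lambda>_. {}) (s(y := b)) \<psi>"
    using sat by auto
  obtain b' where b': "b' \<in> star_tree n" "length b' = length b"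
    using star_tree_same_length[OF b(1) s(5)] by blast
  have "sat (star_tree n) (\<lambda>_. {}) (s'(y := b')) \<psi>"
    using IH[of "s(y := b)" "s'(y := b')"] b b' by simp
  moreover have "sat (star_tree n) (\<lambda>_. {}) (s'(y := b')) \<alpha>"
    using \<alpha> b(2) b'(2) s(1,4) strict_prefix_length_1 star_tree_length[OF b(1)]
      star_tree_length[OF b'(1)] star_tree_length[OF s(2)] star_tree_length[OF s(3)]
    by (auto simp: descendant_eq)
  ultimately show ?thesis using b'(1) by auto
qed

text \<open>Equal length is a bisimulation between stars with at least one leaf; ungraded modalities
  do not see how many leaves there are.\<close>

lemma CoreXPath_star_tree:
  assumes "0 < m" "0 < n" "x \<noteq> y" "s x \<in> star_tree m" "s' x \<in> star_tree n" "length (s x) = length (s' x)"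
  shows "sat (star_tree m) (\<lambda>_. {}) s (st x y \<phi>) \<longleftrightarrow> sat (star_tree n) (\<lambda>_. {}) s' (st x y \<phi>)"
  using assms
proof (induction x y \<phi> arbitrary: m n s s' rule: st.induct)
  case (3 x y \<phi>)
  show ?case using "3.IH"[where s = s and s' = s', OF "3.prems"] by simp
next
  case (4 x y \<phi> \<psi>)
  show ?case using "4.IH"(1)[where s = s and s' = s', OF "4.prems"] "4.IH"(2)[where s = s and s' = s', OF "4.prems"] by simp
next
  case (5 x y \<phi> \<psi>)
  show ?case using "5.IH"(1)[where s = s and s' = s', OF "5.prems"] "5.IH"(2)[where s = s and s' = s', OF "5.prems"] by simp
next
  case (6 x y \<phi>)
  show ?case
    unfolding st.simps
    by (rule iffI; rule star_tree_step[where x = x], rule "6.IH") (use "6.prems" in simp_all)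
next
  case (7 x y \<phi>)
  show ?case
    unfolding st.simps
    by (rule iffI; rule star_tree_step[where x = x], rule "7.IH") (use "7.prems" in simp_all)
next
  case (8 x y \<phi>)
  show ?case
    unfolding st.simps
    by (rule iffI; rule star_tree_step[where x = x], rule "8.IH") (use "8.prems" in simp_all)
next
  case (9 x y \<phi>)
  show ?case
    unfolding st.simps
    by (rule iffI; rule star_tree_step[where x = x], rule "9.IH") (use "9.prems" in simp_all)
qed simp_all

lemma FO2_not_le_CoreXPath:
  fixes P :: "'p set"
  shows "\<not> FO2 P \<preceq>\<^sub>e CoreXPath P"
proof
  assume le: "FO2 P \<preceq>\<^sub>e CoreXPath P"
  \<comment> \<open>Some node is incomparable with the given one; at a leaf of a star this means
    that there is a second leaf.\<close>
  let ?\<phi> = "Ex 1 (Conj (Neg (Equal 0 1)) (Conj (Neg (Desc 0 1)) (Neg (Desc 1 0)))) :: 'p fo"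
  have "?\<phi> \<in> FO2 P" "one_free ?\<phi>" by (auto simp: FO2_def one_free_def)
  then obtain \<psi> where "\<psi> \<in> CoreXPath P" "tree_equiv ?\<phi> \<psi>"
    using le unfolding expr_le_def by blast
  then obtain \<chi> where chi: "tree_equiv ?\<phi> (st 0 1 \<chi>)" by (auto simp: CoreXPath_def)
  have mem: "[0] \<in> star_tree (Suc n)" for n by (auto simp: star_tree_def)
  have "holds_at (star_tree (Suc n)) (\<lambda>_. {}) [0] ?\<phi> \<longleftrightarrow>
      holds_at (star_tree (Suc n)) (\<lambda>_. {}) [0] (st 0 1 \<chi>)" for n
    using chi[unfolded tree_equiv_def, rule_format, OF finite_tree_star mem] .
  moreover have "holds_at (star_tree 1) (\<lambda>_. {}) [0] (st 0 1 \<chi>) \<longleftrightarrow>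
      holds_at (star_tree 2) (\<lambda>_. {}) [0] (st 0 1 \<chi>)"
    unfolding holds_at_def by (rule CoreXPath_star_tree) (use mem[of 0] mem[of 1] in \<open>auto simp: numeral_2_eq_2\<close>)
  moreover have "\<not> holds_at (star_tree 1) (\<lambda>_. {}) [0] ?\<phi>"
    by (auto simp: holds_at_def star_tree_def descendant_def)
  moreover have "holds_at (star_tree 2) (\<lambda>_. {}) [0] ?\<phi>"
    by (auto simp: holds_at_def star_tree_def descendant_def intro!: bexI[of _ "[1]"])
  ultimately show False by (metis One_nat_def numeral_2_eq_2)
qed

text \<open>A two-pebble game: corresponding pebbles have equal length, and the two pebbles coincide
  in both stars or in neither. \<open>R\<close> is this invariant and \<open>extend\<close> the
  answer to a move.\<close>

lemma FO2_star_tree: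
  assumes "2 \<le> m" "2 \<le> n" "counting_free \<phi>" "vars \<phi> \<subseteq> {0, 1}"
    and "\<And>i. i \<in> {0, 1} \<Longrightarrow> s i \<in> star_tree m \<and> s' i \<in> star_tree n \<and> length (s i) = length (s' i)"
    and "s 0 = s 1 \<longleftrightarrow> s' 0 = s' 1"
  shows "sat (star_tree m) (\<lambda>_. {}) s \<phi> \<longleftrightarrow> sat (star_tree n) (\<lambda>_. {}) s' \<phi>"
proof -
  define R where "R m n s s' \<longleftrightarrow> 2 \<le> m \<and> 2 \<le> n \<and>
    (\<forall>i\<in>{0, 1}. s i \<in> star_tree m \<and> s' i \<in> star_tree n \<and> length (s i) = length (s' i)) \<and>
    (s 0 = s 1 \<longleftrightarrow> s' 0 = s' 1)" for m n and s s' :: "nat \<Rightarrow> nat list"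
  have R_sym: "R n m s' s" if "R m n s s'" for m n s s' using that by (auto simp: R_def)
  have extend: "\<exists>b\<in>star_tree n. R m n (s(x := a)) (s'(x := b))"
    if R: "R m n s s'" and x: "x \<in> {0, 1}" and a: "a \<in> star_tree m" for m n s s' x a
  proof -
    define y where "y = 1 - x"
    have xy: "x \<noteq> y" "y \<in> {0, 1}" "{0, 1} = {x, y}" using x by (auto simp: y_def)
    have y: "s y \<in> star_tree m" "s' y \<in> star_tree n" "length (s y) = length (s' y)" "2 \<le> n"
      using R xy(2) by (auto simp: R_def)
    have "\<exists>b\<in>star_tree n. length b = length a \<and> (a = s y \<longleftrightarrow> b = s' y)"
    proof (cases "a = s y")
      case True
      then show ?thesis using y by auto
    next
      case False
      show ?thesis
      proof (cases "a = []")
        case True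
        then show ?thesis using False y by (intro bexI[of _ "[]"]) (auto simp: star_tree_def)
      next
        case False
        then have "length a = 1" using a by (auto simp: star_tree_def)
        moreover have "[0] \<in> star_tree n" "[1] \<in> star_tree n"
          using y(4) by (auto simp: star_tree_def)
        \<comment> \<open>With two leaves available, one of them differs from the pebble that stays
          in place; this is where two leaves are required.\<close>
        moreover have "s' y \<noteq> [0] \<or> s' y \<noteq> [1]" by auto
        ultimately show ?thesis using \<open>a \<noteq> s y\<close> by (metis One_nat_def length_Cons list.size(3))
      qed
    qed
    then obtain b where b: "b \<in> star_tree n" "length b = length a" "a = s y \<longleftrightarrow> b = s' y" by blast
    have "(s(x := a)) 0 = (s(x := a)) 1 \<longleftrightarrow> (s'(x := b)) 0 = (s'(x := b)) 1"
    proof (cases "x = 0")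
      case True
      then show ?thesis using b(3) by (simp add: y_def)
    next
      case False
      then have "x = 1" "y = 0" using x by (simp_all add: y_def)
      then show ?thesis
        using b(3) by (simp add: eq_commute[of "s 0"] eq_commute[of "s' 0"])
    qed
    with b have "R m n (s(x := a)) (s'(x := b))"
      using R a y xy(1) unfolding R_def xy(3) by (simp del: One_nat_def)
    with \<open>b \<in> star_tree n\<close> show ?thesis by blast
  qed
  have "sat (star_tree m) (\<lambda>_. {}) s \<phi> \<longleftrightarrow> sat (star_tree n) (\<lambda>_. {}) s' \<phi>"
    if "R m n s s'" "counting_free \<phi>" "vars \<phi> \<subseteq> {0, 1}" for m n s s'
    using that
  proof (induction \<phi> arbitrary: s s')
    case (Child x y)
    then show ?case
      using strict_prefix_length_1(2) star_tree_length by (auto simp: R_def)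
  next
    case (Desc x y)
    then show ?case
      using strict_prefix_length_1(1) star_tree_length by (auto simp: R_def descendant_eq)
  next
    case (Equal x y)
    then have "x = 0 \<or> x = 1" "y = 0 \<or> y = 1" by auto
    moreover have "s 0 = s 1 \<longleftrightarrow> s' 0 = s' 1" using Equal.prems(1) by (simp add: R_def)
    ultimately show ?case
      by (elim disjE) (simp_all add: eq_commute[of "s (Suc 0)"] eq_commute[of "s' (Suc 0)"])
  next
    case (Ex x \<phi>)
    have x: "x \<in> {0, 1}" and IH: "\<And>s s'. R m n s s' \<Longrightarrow>
        sat (star_tree m) (\<lambda>_. {}) s \<phi> \<longleftrightarrow> sat (star_tree n) (\<lambda>_. {}) s' \<phi>"
      using Ex by auto
    show ?case
      using extend[OF Ex.prems(1) x] extend[OF R_sym[OF Ex.prems(1)] x] IH R_sym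
      unfolding sat.simps by meson
  next
    case (All x \<phi>)
    have x: "x \<in> {0, 1}" and IH: "\<And>s s'. R m n s s' \<Longrightarrow>
        sat (star_tree m) (\<lambda>_. {}) s \<phi> \<longleftrightarrow> sat (star_tree n) (\<lambda>_. {}) s' \<phi>"
      using All by auto
    show ?case
      using extend[OF All.prems(1) x] extend[OF R_sym[OF All.prems(1)] x] IH R_sym
      unfolding sat.simps by meson
  next
    case (Neg \<phi>)
    have "sat (star_tree m) (\<lambda>_. {}) s \<phi> \<longleftrightarrow> sat (star_tree n) (\<lambda>_. {}) s' \<phi>"
      by (rule Neg.IH) (use Neg.prems in auto)
    then show ?case by simp
  next
    case (Conj \<phi> \<psi>)
    have "sat (star_tree m) (\<lambda>_. {}) s \<phi> \<longleftrightarrow> sat (star_tree n) (\<lambda>_. {}) s' \<phi>"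
      by (rule Conj.IH(1)) (use Conj.prems in auto)
    moreover have "sat (star_tree m) (\<lambda>_. {}) s \<psi> \<longleftrightarrow> sat (star_tree n) (\<lambda>_. {}) s' \<psi>"
      by (rule Conj.IH(2)) (use Conj.prems in auto)
    ultimately show ?case by simp
  next
    case (Disj \<phi> \<psi>)
    have "sat (star_tree m) (\<lambda>_. {}) s \<phi> \<longleftrightarrow> sat (star_tree n) (\<lambda>_. {}) s' \<phi>"
      by (rule Disj.IH(1)) (use Disj.prems in auto)
    moreover have "sat (star_tree m) (\<lambda>_. {}) s \<psi> \<longleftrightarrow> sat (star_tree n) (\<lambda>_. {}) s' \<psi>"
      by (rule Disj.IH(2)) (use Disj.prems in auto)
    ultimately show ?case by simp
  qed simp_all
  moreover have "R m n s s'" using assms by (simp add: R_def)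
  ultimately show ?thesis using assms(3,4) by blast
qed

lemma C2_not_le_FO2:
  fixes P :: "'p set"
  shows "\<not> C2 P \<preceq>\<^sub>e FO2 P"
proof
  assume le: "C2 P \<preceq>\<^sub>e FO2 P"
  \<comment> \<open>Two pebbles cannot tell apart stars with two or more leaves, so three is the
    least threshold on children that separates such stars.\<close>
  let ?\<phi> = "AtLeast 3 1 (Child 0 1) :: 'p fo"
  have "?\<phi> \<in> C2 P" "one_free ?\<phi>" by (auto simp: C2_def one_free_def)
  then obtain \<psi> where psi: "\<psi> \<in> FO2 P" "tree_equiv ?\<phi> \<psi>"
    using le unfolding expr_le_def by blast
  have mem: "[] \<in> star_tree n" for n by (simp add: star_tree_def)
  have "holds_at (star_tree n) (\<lambda>_. {}) [] ?\<phi> \<longleftrightarrow> holds_at (star_tree n) (\<lambda>_. {}) [] \<psi>" for n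
    using psi(2)[unfolded tree_equiv_def, rule_format, OF finite_tree_star mem] .
  moreover have "holds_at (star_tree 2) (\<lambda>_. {}) [] \<psi> \<longleftrightarrow> holds_at (star_tree 3) (\<lambda>_. {}) [] \<psi>"
    unfolding holds_at_def by (rule FO2_star_tree) (use psi(1) mem in \<open>auto simp: FO2_def\<close>)
  moreover have "holds_at (star_tree n) (\<lambda>_. {}) [] ?\<phi> \<longleftrightarrow> 3 \<le> n" for n
  proof -
    have "{a \<in> star_tree n. child [] a} = (\<lambda>i. [i]) ` {..<n}"
      by (auto simp: star_tree_def child_def)
    then have "card {a \<in> star_tree n. child [] a} = n"
      by (simp add: card_image inj_on_def)
    then show ?thesis by (simp add: holds_at_def)
  qed
  ultimately show False by (metis eval_nat_numeral(3) not_less_eq_eq order_refl)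
qed

theorem theorem5p2:
  fixes P :: "'p set"
  assumes "finite P"
  shows "CoreXPath P \<equiv>\<^sub>e GF2 P \<and> GF2 P \<equiv>\<^sub>e UNFO P \<and> UNFO P \<prec>\<^sub>e FO2 P
    \<and> FO2 P \<prec>\<^sub>e C2 P \<and> C2 P \<equiv>\<^sub>e F1 P"
proof (intro conjI)
  note to_CoreXPath = GF2_le_CoreXPath[OF assms] UNFO_le_CoreXPath[OF assms]
    and from_CoreXPath = CoreXPath_subset[of P, THEN expr_le_subset]
  show "CoreXPath P \<equiv>\<^sub>e GF2 P" "GF2 P \<equiv>\<^sub>e UNFO P"
    unfolding expr_eq_def using to_CoreXPath from_CoreXPath expr_le_trans by blast+
  show "UNFO P \<prec>\<^sub>e FO2 P"
    unfolding expr_less_def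
    using to_CoreXPath(2) from_CoreXPath(3) expr_le_trans FO2_not_le_CoreXPath by blast
  have "FO2 P \<subseteq> C2 P" by (auto simp: FO2_def C2_def)
  then show "FO2 P \<prec>\<^sub>e C2 P"
    unfolding expr_less_def using expr_le_subset C2_not_le_FO2 by blast
  show "C2 P \<equiv>\<^sub>e F1 P"
    unfolding expr_eq_def using C2_le_F1 F1_le_C2[OF assms] by blast
qed

end
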